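(* Let $\{z^t\}$ be the sequence of SQG regression estimates at a point $x\in X$. Assume that (i) for all $t$ the tracked regressions satisfy $y^t(x)\in Y(x)$ and $\|y^{t+1}(x)-y^t(x)\|\le\delta_t(x)\to0$ as $t\to\infty$; (ii) all densities $g^t(x,y)$ are globally Hölder continuous in the first argument with constants $\nu>0$, $L(y)$, where $\int_YL(y)\,dy<\infty$ and $\int_Y\|y\|^2L(y)\,dy<\infty$, and satisfy $\sup_{y\in Y(x)}\|y\|<\infty$, $g_1(x)\le g_1^t(x)\le\overline g_1$ and $\int_Y\|y\|^2g_2^t(y)\,dy\le\overline g_3<\infty$ for all $t$; (iii) the kernel $K$ is a bounded Borel density with $\int_X K(u)\,du=1$, $\sup_{u\in X} K(u)\le\overline K$, and $\int_{\mathbb{R}^r}\|u\|^{\nu}K(u)\,du<+\infty$; (iv) the adjustment coefficients $\rho_t>0$ and window parameters $\theta_t>0$ are deterministic and satisfy $$\lim_{t\to\infty}\frac{\delta_t(x)}{\rho_t}=0,\qquad \lim_{t\to\infty}\rho_t=\lim_{t\to\infty}\theta_t=0\ \text{ a.s.},\qquad \sum_{t=0}^{\infty}\rho_t=+\infty\ \text{ a.s.},\qquad \sum_{t=0}^{\infty}\mathbf{E}\frac{\rho_t^2}{\theta_t^r}<+\infty$$ (the qualifiers "a.s." and $\mathbf{E}$ being vacuous for deterministic sequences). Then at any point $x$ where all $g_1^t(x)\ge g_1(x)>0$, with probability one $$\lim_{t\to\infty}(z^t-y^t(x))=0.$$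
   Context: Let $X\subseteq\mathbb{R}^r$, $Y\subseteq\mathbb{R}^m$. For $t=0,1,\dots$, $g^t(x,y)$ is a probability density on $X\times Y$ with marginals $g_1^t(x)=\int_Yg^t(x,y)\,dy$ and $g_2^t(y)=\int_Xg^t(x,y)\,dx$, and regression function $y^t(x)=\int_Yy\,g^t(x,y)\,dy/g_1^t(x)$. $Y(x)\subseteq\mathbb{R}^m$ is a convex compact set; $g_1(\cdot)$ is a given lower bound function and $\overline g_1,\overline g_3$ are finite constants. $K\ge0$ is a kernel. Global Hölder continuity of the densities in the first argument: for almost all $y\in Y$, $|g^t(x_1,y)-g^t(x_2,y)|\le L(y)\|x_1-x_2\|^{\nu}$ for $x_1,x_2\in X$ and all $t$. Observations: for each $t$, pairs $(\overline x_{ti},\overline y_{ti})$, $i=1,\dots,N_t$ ($N_t\ge1$), are sampled from $g^t$; all observations over all $t,i$ are independent. SQG regression estimates at $x$: given $z^0\in Y(x)$, $$z^{t+1}=\Pi_{Y(x)}(z^t-\rho_t\xi_t),\qquad \xi_t=\frac1{\theta_t^rN_t}\sum_{i=1}^{N_t}K\Big(\frac{\overline x_{ti}-x}{\theta_t}\Big)(z^t-\overline y_{ti}),\quad t=0,1,\dots,$$ where $\Pi_{Y(x)}$ is Euclidean projection onto $Y(x)$. $\mathbf{E}$ denotes expectation.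
   Formalization: Adds that the integral of K over {u : x+θ_t u ∈ X} stays above a positive constant for large t (automatic at interior points of X, and for X=R^r); without it the claim fails, e.g. X=[0,1], x=1, K the indicator of [0,1], where the estimates never move. *)

theory Defs
  imports "HOL-Probability.Probability"
begin

definition density_on ::
    "(real^'r) set \<Rightarrow> (real^'m) set \<Rightarrow> (real^'r \<Rightarrow> real^'m \<Rightarrow> real) \<Rightarrow> bool" where
  "density_on X Y g \<longleftrightarrow>
     set_borel_measurable lborel (X \<times> Y) (\<lambda>(x, y). g x y) \<and>
     (\<forall>x\<in>X. \<forall>y\<in>Y. 0 \<le> g x y) \<and>
     set_integrable lborel (X \<times> Y) (\<lambda>(x, y). g x y) \<and>
     (LINT p:X \<times> Y|lborel. (case p of (x, y) \<Rightarrow> g x y)) = 1"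

definition marginal1 ::
    "(real^'m) set \<Rightarrow> (real^'r \<Rightarrow> real^'m \<Rightarrow> real) \<Rightarrow> real^'r \<Rightarrow> real" where
  "marginal1 Y g x = (LINT y:Y|lborel. g x y)"

definition marginal2 ::
    "(real^'r) set \<Rightarrow> (real^'r \<Rightarrow> real^'m \<Rightarrow> real) \<Rightarrow> real^'m \<Rightarrow> real" where
  "marginal2 X g y = (LINT x:X|lborel. g x y)"

definition regression ::
    "(real^'m) set \<Rightarrow> (real^'r \<Rightarrow> real^'m \<Rightarrow> real) \<Rightarrow> real^'r \<Rightarrow> real^'m" where
  "regression Y g x = (LINT y:Y|lborel. g x y *\<^sub>R y) /\<^sub>R marginal1 Y g x"

text \<open>A pair of random vectors is sampled from a density on \<open>X \<times> Y\<close>; the density is extended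
  by zero outside \<open>X \<times> Y\<close>, so the values of \<open>g\<close> there play no role.\<close>

definition sampled_from ::
    "'w measure \<Rightarrow> (real^'r) set \<Rightarrow> (real^'m) set \<Rightarrow> (real^'r \<Rightarrow> real^'m \<Rightarrow> real) \<Rightarrow>
     ('w \<Rightarrow> real^'r) \<Rightarrow> ('w \<Rightarrow> real^'m) \<Rightarrow> bool" where
  "sampled_from M X Y g xo yo \<longleftrightarrow>
     distributed M lborel (\<lambda>\<omega>. (xo \<omega>, yo \<omega>))
       (\<lambda>(x, y). ennreal (indicator (X \<times> Y) (x, y) * g x y))"

definition globally_hoelder ::
    "(real^'r) set \<Rightarrow> (real^'m) set \<Rightarrow> real \<Rightarrow> (real^'m \<Rightarrow> real) \<Rightarrow>
     (nat \<Rightarrow> real^'r \<Rightarrow> real^'m \<Rightarrow> real) \<Rightarrow> bool" where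
  "globally_hoelder X Y \<nu> L g \<longleftrightarrow>
     (AE y in lborel. y \<in> Y \<longrightarrow>
        (\<forall>t. \<forall>x1\<in>X. \<forall>x2\<in>X. \<bar>g t x1 y - g t x2 y\<bar> \<le> L y * norm (x1 - x2) powr \<nu>))"

definition sqg_direction ::
    "(real^'r \<Rightarrow> real) \<Rightarrow> real^'r \<Rightarrow> real \<Rightarrow> nat \<Rightarrow> (nat \<Rightarrow> real^'r) \<Rightarrow> (nat \<Rightarrow> real^'m) \<Rightarrow>
     real^'m \<Rightarrow> real^'m" where
  "sqg_direction K x \<theta> n xs ys z =
     (1 / (\<theta> ^ CARD('r) * real n)) *\<^sub>R
       (\<Sum>i\<in>{1..n}. K ((xs i - x) /\<^sub>R \<theta>) *\<^sub>R (z - ys i))"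

text \<open>Here \<open>C\<close> is the set projected onto; for a nonempty closed convex set \<^const>\<open>closest_point\<close>
  is the Euclidean projection.\<close>

primrec sqg_estimate ::
    "(real^'m) set \<Rightarrow> (real^'r \<Rightarrow> real) \<Rightarrow> real^'r \<Rightarrow> (nat \<Rightarrow> real) \<Rightarrow> (nat \<Rightarrow> real) \<Rightarrow> (nat \<Rightarrow> nat) \<Rightarrow>
     (nat \<Rightarrow> nat \<Rightarrow> real^'r) \<Rightarrow> (nat \<Rightarrow> nat \<Rightarrow> real^'m) \<Rightarrow> real^'m \<Rightarrow> nat \<Rightarrow> real^'m" where
  "sqg_estimate C K x \<rho> \<theta> N xs ys z0 0 = z0"
| "sqg_estimate C K x \<rho> \<theta> N xs ys z0 (Suc t) =
     (let z = sqg_estimate C K x \<rho> \<theta> N xs ys z0 t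
      in closest_point C (z - \<rho> t *\<^sub>R sqg_direction K x (\<theta> t) (N t) (xs t) (ys t) z))"

text \<open>The kernel windows around \<open>x\<close> must not lose all of their mass outside \<open>X\<close> as they shrink.
  For \<open>X = UNIV\<close>, and at every interior point of \<open>X\<close>, this follows from the normalisation of
  \<open>K\<close> (lemmas below). At a boundary point the normalisation \<open>\<integral>\<^sub>X K = 1\<close> alone does not
  exclude a complete loss: for \<open>X = {0..1}\<close>, \<open>x = 1\<close> and \<open>K = indicator {0..1}\<close> all
  directions \<open>\<xi>\<^sub>t\<close> vanish almost surely and the estimates never move.\<close>

definition window_retained ::
    "(real^'r) set \<Rightarrow> (real^'r \<Rightarrow> real) \<Rightarrow> real^'r \<Rightarrow> (nat \<Rightarrow> real) \<Rightarrow> bool" where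
  "window_retained X K x \<theta> \<longleftrightarrow>
     (\<exists>c>0. \<forall>\<^sub>F t in sequentially. c \<le> (LINT u:{u. x + \<theta> t *\<^sub>R u \<in> X}|lborel. K u))"

lemma window_retained_UNIV:
  assumes "(LINT u:UNIV|lborel. K u) = 1"
  shows "window_retained UNIV K x \<theta>"
  unfolding window_retained_def using assms by (intro exI[of _ 1]) simp

lemma window_retained_interior:
  fixes K :: "real^'r \<Rightarrow> real"
  assumes X: "X \<in> sets borel" and x: "x \<in> interior X"
    and K0: "\<And>u. 0 \<le> K u" and K: "integrable lborel K" and K1: "(LINT u:X|lborel. K u) = 1"
    and \<theta>: "\<theta> \<longlonglongrightarrow> 0"
  shows "window_retained X K x \<theta>"
proof -
  let ?A = "\<lambda>t. {u. x + \<theta> t *\<^sub>R u \<in> X}"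
  have meas: "?A t \<in> sets lborel" for t
  proof -
    have "(\<lambda>u. x + \<theta> t *\<^sub>R u) -` X \<inter> space borel \<in> sets borel"
      by (rule measurable_sets[OF _ X]) measurable
    then show ?thesis by (simp add: vimage_def)
  qed
  have lim: "(\<lambda>t. indicator (?A t) u *\<^sub>R K u) \<longlonglongrightarrow> K u" for u
  proof -
    have "(\<lambda>t. x + \<theta> t *\<^sub>R u) \<longlonglongrightarrow> x + 0 *\<^sub>R u"
      by (intro tendsto_intros \<theta>)
    then have "\<forall>\<^sub>F t in sequentially. x + \<theta> t *\<^sub>R u \<in> interior X"
      using x by (auto dest!: topological_tendstoD[where S = "interior X"])
    then have "\<forall>\<^sub>F t in sequentially. indicator (?A t) u *\<^sub>R K u = K u"
      by eventually_elim (use interior_subset in \<open>auto simp: indicator_def\<close>)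
    then show ?thesis by (rule tendsto_eventually)
  qed
  have *: "(\<lambda>t. LINT u|lborel. indicator (?A t) u *\<^sub>R K u) \<longlonglongrightarrow> (LINT u|lborel. K u)"
  proof (rule integral_dominated_convergence[where w = K])
    show "(\<lambda>u. indicator (?A t) u *\<^sub>R K u) \<in> borel_measurable lborel" for t
      using meas[of t] borel_measurable_integrable[OF K] by measurable
  qed (use K lim K0 in \<open>auto simp: indicator_def borel_measurable_integrable\<close>)
  have "1 \<le> (LINT u|lborel. K u)"
    unfolding K1[symmetric] set_lebesgue_integral_def
  proof (rule integral_mono)
    show "integrable lborel (\<lambda>u. indicator X u *\<^sub>R K u)"
      using integrable_mult_indicator[of X lborel K] X K by simp
  qed (use K K0 in \<open>auto simp: indicator_def\<close>)
  then have "1 / 2 < (LINT u|lborel. K u)" by simp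
  from order_tendstoD(1)[OF * this] show ?thesis
    unfolding window_retained_def set_lebesgue_integral_def
    by (intro exI[of _ "1/2"]) (auto elim: eventually_mono)
qed

end

theory Submission
  imports Defs
begin

text \<open>The squared tracking error \<open>V\<^sub>t = \<parallel>z\<^sup>t - y\<^sup>t(x)\<parallel>\<^sup>2\<close> is a stochastic Lyapunov function. Hoelder
  continuity of the densities makes the mean direction equal to \<open>w\<^sub>t (z - y\<^sup>t(x))\<close> up to \<open>O(\<theta>\<^sub>t\<^sup>\<nu>)\<close>,
  where \<open>w\<^sub>t\<close>, the retained kernel mass times the first marginal density at \<open>x\<close>, stays away from 0.
  Since the projection is nonexpansive, this gives
  \<open>V\<^bsub>t+1\<^esub> \<le> (1 - 2\<kappa>\<rho>\<^sub>t) V\<^sub>t + o(\<rho>\<^sub>t) + \<rho>\<^sub>t\<^sup>2 \<parallel>\<xi>\<^sub>t\<parallel>\<^sup>2 + d\<^sub>t\<close> with martingale differences \<open>d\<^sub>t\<close>.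
  The second moments of \<open>\<xi>\<^sub>t\<close> are \<open>O(\<theta>\<^sub>t\<^sup>-\<^sup>r)\<close>, so that almost surely \<open>\<Sum> \<rho>\<^sub>t\<^sup>2 \<parallel>\<xi>\<^sub>t\<parallel>\<^sup>2\<close> is finite and, by
  Kolmogorov's maximal inequality, \<open>\<Sum> d\<^sub>t\<close> converges. Adding the tails of these two series to \<open>V\<^sub>t\<close>
  leaves a contraction with \<open>\<Sum> \<rho>\<^sub>t = \<infinity>\<close>, which forces \<open>V\<^sub>t \<rightarrow> 0\<close>.\<close>

section \<open>A perturbed contraction\<close>

text \<open>For a fixed estimate the mean direction is affine in it, of the form a z - b. The
  densities therefore enter only through the means of the scaled kernel and of the kernel times the
  response, together with the kernel-weighted second moment of the response. All three are instances
  of one smoothing estimate, with weights 1, y and |y|^2. Positivity of the marginal at x lets b be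
  compared with w times the regression value, which is why the descent points at the regression. The
  proof is cut at this interface, \<open>projected_regression\<close>, which knows the moments but
  not the densities. Squaring the direction produces the square of the scaled kernel, which is at
  most its supremum times the kernel itself. This costs one factor theta^(-r) and not two, matching
  the summability of rho^2 / theta^r. Compactness of the projection set bounds every error vector,
  so the bias and the motion of the target enter the squared error linearly, as rho times (bias +
  delta / rho).\<close>

lemma contraction_recursion_upper_bound:
  fixes U \<rho> :: "nat \<Rightarrow> real"
  assumes rec: "\<And>t. t \<ge> m \<Longrightarrow> U (Suc t) - \<epsilon> \<le> (1 - \<rho> t) * (U t - \<epsilon>)"
    and \<rho>: "\<And>t. t \<ge> m \<Longrightarrow> 0 \<le> \<rho> t \<and> \<rho> t \<le> 1"
  shows "U (m + n) - \<epsilon> \<le> exp (- (\<Sum>t=m..<m+n. \<rho> t)) * max 0 (U m - \<epsilon>)"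
proof (induction n)
  case (Suc n)
  let ?E = "exp (- (\<Sum>t=m..<m+n. \<rho> t)) * max 0 (U m - \<epsilon>)"
  \<comment> \<open>The truncation at 0 keeps the bound nonnegative even when \<open>U m\<close>
    lies below \<open>\<epsilon>\<close>; only then may the factor 1 - r be enlarged to exp (-
    r).\<close>
  have E: "0 \<le> ?E" by simp
  have "U (m + Suc n) - \<epsilon> \<le> (1 - \<rho> (m + n)) * (U (m + n) - \<epsilon>)" using rec[of "m + n"] by simp
  also have "\<dots> \<le> (1 - \<rho> (m + n)) * ?E"
    using Suc \<rho>[of "m + n"] by (intro mult_left_mono) auto
  also have "\<dots> \<le> exp (- \<rho> (m + n)) * ?E"
    using E exp_ge_add_one_self[of "- \<rho> (m + n)"] by (intro mult_right_mono) auto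
  also have "\<dots> = exp (- (\<Sum>t=m..<m + Suc n. \<rho> t)) * max 0 (U m - \<epsilon>)"
    by (simp add: exp_add[symmetric] mult.assoc[symmetric] exp_diff exp_minus divide_simps mult.commute)
  finally show ?case .
qed simp

text \<open>Passing to \<open>V + R\<close>, with \<open>R\<close> the sum of the two tails, absorbs
  both additive series exactly. The price is the perturbation
  \<open>\<rho> t * (\<eta> t + \<kappa> * R t)\<close>, which is small compared with
  \<open>\<rho> t\<close>. The shifted sequence may be negative, so only an upper bound is derived
  for it; the lower bound comes from nonnegativity of \<open>V\<close>.\<close>

lemma stochastic_approximation_recursion:
  fixes V \<rho> \<eta> \<beta> S :: "nat \<Rightarrow> real"
  assumes rec: "\<forall>\<^sub>F t in sequentially.
      V (Suc t) \<le> (1 - \<kappa> * \<rho> t) * V t + \<rho> t * \<eta> t + \<beta> t + (S (Suc t) - S t)"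
    and V: "\<And>t. 0 \<le> V t" and \<kappa>: "0 < \<kappa>" and \<rho>: "\<And>t. 0 < \<rho> t" and \<rho>0: "\<rho> \<longlonglongrightarrow> 0"
    and div: "filterlim (\<lambda>n. \<Sum>t<n. \<rho> t) at_top sequentially"
    and \<eta>: "\<eta> \<longlonglongrightarrow> 0" and \<beta>: "summable \<beta>" and S: "convergent S"
  shows "V \<longlonglongrightarrow> 0"
proof -
  define R where "R = (\<lambda>t. (lim S - S t) + (suminf \<beta> - (\<Sum>s<t. \<beta> s)))"
  have R: "R \<longlonglongrightarrow> 0"
  proof -
    have "R \<longlonglongrightarrow> (lim S - lim S) + (suminf \<beta> - suminf \<beta>)"
      unfolding R_def using S \<beta> by (intro tendsto_intros) (auto simp: convergent_LIMSEQ_iff summable_LIMSEQ)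
    then show ?thesis by simp
  qed
  define U where "U = (\<lambda>t. V t + R t)"
  have "\<forall>\<^sub>F t in sequentially. U t < e" if e: "e > 0" for e
  proof -
    have "(\<lambda>t. \<eta> t + \<kappa> * R t) \<longlonglongrightarrow> 0 + \<kappa> * 0" by (intro tendsto_intros \<eta> R)
    then have 1: "\<forall>\<^sub>F t in sequentially. \<eta> t + \<kappa> * R t < \<kappa> * (e / 2)"
      using e \<kappa> by (intro order_tendstoD(2)) auto
    have "(\<lambda>t. \<kappa> * \<rho> t) \<longlonglongrightarrow> \<kappa> * 0" by (intro tendsto_intros \<rho>0)
    then have 2: "\<forall>\<^sub>F t in sequentially. \<kappa> * \<rho> t < 1" by (intro order_tendstoD(2)) auto
    from eventually_conj[OF rec eventually_conj[OF 1 2]]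
    obtain m where m: "\<And>t. t \<ge> m \<Longrightarrow>
        V (Suc t) \<le> (1 - \<kappa> * \<rho> t) * V t + \<rho> t * \<eta> t + \<beta> t + (S (Suc t) - S t)"
      "\<And>t. t \<ge> m \<Longrightarrow> \<eta> t + \<kappa> * R t < \<kappa> * (e / 2)" "\<And>t. t \<ge> m \<Longrightarrow> \<kappa> * \<rho> t < 1"
      unfolding eventually_sequentially by blast
    \<comment> \<open>The level e/2 is the equilibrium of the recursion with perturbation
      \<open>\<rho> t * (\<kappa> * (e / 2))\<close>, so subtracting it leaves a pure contraction.
      The other half of e is reserved for the decaying exponential.\<close>
    have step: "U (Suc t) - e/2 \<le> (1 - \<kappa> * \<rho> t) * (U t - e/2)" if t: "t \<ge> m" for t
    proof -
      have "\<rho> t * (\<eta> t + \<kappa> * R t) \<le> \<rho> t * (\<kappa> * (e / 2))"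
        using m(2)[OF t] \<rho>[of t] by (intro mult_left_mono) auto
      moreover have "R (Suc t) = R t - \<beta> t - (S (Suc t) - S t)" by (simp add: R_def)
      ultimately show ?thesis using m(1)[OF t] by (simp add: U_def algebra_simps)
    qed
    let ?M = "max 0 (U m - e/2)"
    have "filterlim (\<lambda>n. \<Sum>t<n + m. \<rho> t) at_top sequentially"
      using div by (rule filterlim_compose) (rule filterlim_add_const_nat_at_top)
    then have "filterlim (\<lambda>n. - (\<Sum>t<m. \<rho> t) + (\<Sum>t<n + m. \<rho> t)) at_top sequentially"
      by (rule filterlim_tendsto_add_at_top[OF tendsto_const])
    moreover have "- (\<Sum>t<m. \<rho> t) + (\<Sum>t<n + m. \<rho> t) = (\<Sum>t=m..<m+n. \<rho> t)" for n
      using sum_diff_nat_ivl[of 0 m "m + n" \<rho>] by (simp add: lessThan_atLeast0 add.commute)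
    ultimately have "filterlim (\<lambda>n. \<kappa> * (\<Sum>t=m..<m+n. \<rho> t)) at_top sequentially"
      using \<kappa> by (auto intro: filterlim_tendsto_pos_mult_at_top[OF tendsto_const])
    then have "(\<lambda>n. exp (- (\<kappa> * (\<Sum>t=m..<m+n. \<rho> t))) * ?M) \<longlonglongrightarrow> 0 * ?M"
      by (intro tendsto_mult tendsto_const filterlim_compose[OF exp_at_bot])
        (auto simp: filterlim_uminus_at_top)
    then have ev: "\<forall>\<^sub>F n in sequentially. exp (- (\<kappa> * (\<Sum>t=m..<m+n. \<rho> t))) * ?M < e/2"
      using e by (intro order_tendstoD(2)) auto
    have bnd: "U (m + n) - e/2 \<le> exp (- (\<kappa> * (\<Sum>t=m..<m+n. \<rho> t))) * ?M" for n
      unfolding sum_distrib_left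
      using m(3) \<rho> \<kappa> step
      by (intro contraction_recursion_upper_bound[where \<rho> = "\<lambda>t. \<kappa> * \<rho> t"]) (auto simp: less_imp_le)
    from ev have "\<forall>\<^sub>F n in sequentially. U (n + m) < e"
    proof eventually_elim
      case (elim n)
      then show ?case using bnd[of n] by (simp add: add.commute)
    qed
    then show ?thesis by (rule eventually_sequentially_seg[THEN iffD1])
  qed
  note U = this
  show ?thesis
  proof (rule order_tendstoI)
    fix a :: real assume "a < 0"
    then have "a < V t" for t using V[of t] by linarith
    then show "\<forall>\<^sub>F t in sequentially. a < V t" by simp
  next
    fix a :: real assume a: "0 < a"
    have "\<forall>\<^sub>F t in sequentially. - (a/2) < R t" using R a by (intro order_tendstoD(1)) auto
    moreover have "\<forall>\<^sub>F t in sequentially. U t < a/2" using U[of "a/2"] a by simp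
    ultimately show "\<forall>\<^sub>F t in sequentially. V t < a"
      by eventually_elim (simp add: U_def)
  qed
qed

section \<open>Convergence of martingale sums\<close>

text \<open>Orthogonality to the square-integrable functions of the past replaces the condition that
  the conditional expectation of \<open>d t\<close> given \<open>F t\<close> vanishes.\<close>

locale martingale_differences = prob_space M for M :: "'a measure" +
  fixes F :: "nat \<Rightarrow> 'a measure" and d :: "nat \<Rightarrow> 'a \<Rightarrow> real"
  assumes space_F: "\<And>t. space (F t) = space M" and sets_F: "\<And>t. sets (F t) \<subseteq> sets M"
    and mono_F: "\<And>s t. s \<le> t \<Longrightarrow> sets (F s) \<subseteq> sets (F t)"
    and d_adapted: "\<And>t. d t \<in> borel_measurable (F (Suc t))"
    and d_square: "\<And>t. integrable M (\<lambda>\<omega>. (d t \<omega>)\<^sup>2)"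
    and d_orthogonal: "\<And>t f. f \<in> borel_measurable (F t) \<Longrightarrow> integrable M (\<lambda>\<omega>. (f \<omega>)\<^sup>2) \<Longrightarrow>
          (\<integral>\<omega>. d t \<omega> * f \<omega> \<partial>M) = 0"
begin

lemma measurable_F_mono: "s \<le> t \<Longrightarrow> f \<in> borel_measurable (F s) \<Longrightarrow> f \<in> borel_measurable (F t)"
  using mono_F[of s t] space_F by (auto simp: measurable_def)

lemma measurable_F_M: "f \<in> borel_measurable (F s) \<Longrightarrow> f \<in> borel_measurable M"
  using sets_F[of s] space_F by (auto simp: measurable_def)

lemma d_measurable_later: "s < t \<Longrightarrow> d s \<in> borel_measurable (F t)"
  using measurable_F_mono[of "Suc s" t, OF _ d_adapted] by simp

lemma d_measurable [measurable]: "d t \<in> borel_measurable M"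
  by (rule measurable_F_M[OF d_adapted])

lemma integrable_mult_square:
  fixes f h :: "'a \<Rightarrow> real"
  assumes [measurable]: "f \<in> borel_measurable M" "h \<in> borel_measurable M"
    and "integrable M (\<lambda>\<omega>. (f \<omega>)\<^sup>2)" "integrable M (\<lambda>\<omega>. (h \<omega>)\<^sup>2)"
  shows "integrable M (\<lambda>\<omega>. f \<omega> * h \<omega>)"
proof (rule Bochner_Integration.integrable_bound)
  show "integrable M (\<lambda>\<omega>. (f \<omega>)\<^sup>2 + (h \<omega>)\<^sup>2)" using assms by auto
  have "\<bar>f \<omega> * h \<omega>\<bar> \<le> (f \<omega>)\<^sup>2 + (h \<omega>)\<^sup>2" for \<omega>
    using sum_squares_bound[of "\<bar>f \<omega>\<bar>" "\<bar>h \<omega>\<bar>"] zero_le_mult_iff[of "\<bar>f \<omega>\<bar>" "\<bar>h \<omega>\<bar>"]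
    unfolding abs_mult power2_abs by linarith
  then show "AE \<omega> in M. norm (f \<omega> * h \<omega>) \<le> norm ((f \<omega>)\<^sup>2 + (h \<omega>)\<^sup>2)" by simp
qed simp

text \<open>The cross term vanishes because the partial sum up to n is known at time n.
  Orthogonality applies only to square-integrable functions, so integrability has to be carried
  through the same induction.\<close>

lemma second_moment_sum:
  "integrable M (\<lambda>\<omega>. (\<Sum>t<n. d t \<omega>)\<^sup>2) \<and>
   (\<integral>\<omega>. (\<Sum>t<n. d t \<omega>)\<^sup>2 \<partial>M) = (\<Sum>t<n. \<integral>\<omega>. (d t \<omega>)\<^sup>2 \<partial>M)"
proof (induction n)
  case (Suc n)
  let ?S = "\<lambda>\<omega>. \<Sum>t<n. d t \<omega>"
  have S: "?S \<in> borel_measurable (F n)"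
    by (intro borel_measurable_sum d_measurable_later) auto
  have i: "integrable M (\<lambda>\<omega>. d n \<omega> * ?S \<omega>)"
    using Suc S d_square measurable_F_M[OF S] by (intro integrable_mult_square) auto
  have eq: "(\<Sum>t<Suc n. d t \<omega>)\<^sup>2 = (?S \<omega>)\<^sup>2 + 2 * (d n \<omega> * ?S \<omega>) + (d n \<omega>)\<^sup>2" for \<omega>
    by (simp add: power2_eq_square algebra_simps)
  show ?case unfolding eq
    using Suc i d_square d_orthogonal[OF S] by simp
qed simp

text \<open>Restarting at time m lets the maximal inequality control the oscillation of the partial
  sums after m.\<close>

lemma shifted: "martingale_differences M (\<lambda>t. F (m + t)) (\<lambda>t. d (m + t))"
  using d_adapted[of "m + _"]
  by unfold_locales (auto simp: space_F d_square d_orthogonal intro: sets_F[THEN subsetD] mono_F[THEN subsetD, rotated])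

text \<open>Kolmogorov's argument: stopping keeps the differences orthogonal to the past and does
  not increase their second moments. On the event in question the stopped sum has absolute value at
  least \<open>\<epsilon>\<close> at the fixed time n, where Markov's inequality for its square
  applies.\<close>

lemma maximal_inequality:
  assumes \<epsilon>: "\<epsilon> > 0"
  shows "prob {\<omega> \<in> space M. \<exists>k\<le>n. \<epsilon> \<le> \<bar>\<Sum>t<k. d t \<omega>\<bar>} \<le> (\<Sum>t<n. \<integral>\<omega>. (d t \<omega>)\<^sup>2 \<partial>M) / \<epsilon>\<^sup>2"
proof -
  txt \<open>The differences stopped at the first time at which the partial sums leave the interval.\<close>
  define B where "B = (\<lambda>t \<omega>. \<forall>j\<le>t. \<bar>\<Sum>s<j. d s \<omega>\<bar> < \<epsilon>)"
  define c where "c = (\<lambda>t \<omega>. if B t \<omega> then d t \<omega> else 0)"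
  \<comment> \<open>\<open>B t\<close> involves only differences with index below t, so whether
    \<open>d t\<close> is kept is already decided at time t.\<close>
  have B: "Measurable.pred (F t) (B t)" for t
  proof -
    have [measurable]: "(\<lambda>\<omega>. \<Sum>s<j. d s \<omega>) \<in> borel_measurable (F t)" if "j \<le> t" for j
      using that by (intro borel_measurable_sum d_measurable_later) auto
    have "Measurable.pred (F t) (\<lambda>\<omega>. \<forall>j\<in>{..t}. \<bar>\<Sum>s<j. d s \<omega>\<bar> < \<epsilon>)"
      by (intro pred_intros_finite) auto
    then show ?thesis by (simp add: B_def Ball_def)
  qed
  have B': "Measurable.pred (F (Suc t)) (B t)" for t
    using B[of t] mono_F[of t "Suc t"] by (auto simp: measurable_def space_F)
  have le: "(c t \<omega>)\<^sup>2 \<le> (d t \<omega>)\<^sup>2" for t \<omega> by (simp add: c_def)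
  have c_meas: "c t \<in> borel_measurable (F (Suc t))" for t
    unfolding c_def using B' d_adapted by measurable
  have sq: "integrable M (\<lambda>\<omega>. (c t \<omega>)\<^sup>2)" for t
    by (rule Bochner_Integration.integrable_bound[OF d_square[of t]])
      (use le measurable_F_M[OF c_meas] in auto)
  interpret c: martingale_differences M F c
  proof
    fix t and f :: "'a \<Rightarrow> real" assume f: "f \<in> borel_measurable (F t)" "integrable M (\<lambda>\<omega>. (f \<omega>)\<^sup>2)"
    \<comment> \<open>The stopping indicator is moved from the difference to the test function,
      where predictability makes it admissible.\<close>
    let ?h = "\<lambda>\<omega>. if B t \<omega> then f \<omega> else 0"
    have h: "?h \<in> borel_measurable (F t)" using f B by measurable
    have "integrable M (\<lambda>\<omega>. (?h \<omega>)\<^sup>2)"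
      by (rule Bochner_Integration.integrable_bound[OF f(2)]) (use measurable_F_M[OF h] in auto)
    from d_orthogonal[OF h this] show "(\<integral>\<omega>. c t \<omega> * f \<omega> \<partial>M) = 0"
      by (simp add: c_def if_distrib if_distribR cong: if_cong)
  qed (use sq c_meas space_F mono_F sets_F in auto)
  let ?T = "\<lambda>\<omega>. (\<Sum>t<n. c t \<omega>)"
  have stop: "\<epsilon>\<^sup>2 \<le> (?T \<omega>)\<^sup>2" if ex: "\<exists>k\<le>n. \<epsilon> \<le> \<bar>\<Sum>t<k. d t \<omega>\<bar>" for \<omega>
  proof -
    \<comment> \<open>At the first exit time k, exactly the differences with index below k survive.
      The stopped sum thus includes the increment that crosses the threshold and stays frozen at the
      exit value.\<close>
    define k where "k = (LEAST k. \<epsilon> \<le> \<bar>\<Sum>t<k. d t \<omega>\<bar>)"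
    have k: "\<epsilon> \<le> \<bar>\<Sum>t<k. d t \<omega>\<bar>" unfolding k_def using ex by (auto intro: LeastI)
    have kn: "k \<le> n" unfolding k_def using ex by (auto intro: Least_le order_trans)
    have "B t \<omega> \<longleftrightarrow> t < k" for t
    proof
      show "B t \<omega>" if "t < k"
        unfolding B_def using not_less_Least[of _ "\<lambda>k. \<epsilon> \<le> \<bar>\<Sum>t<k. d t \<omega>\<bar>", folded k_def] that
        by (meson le_less_trans not_le)
      show "t < k" if "B t \<omega>" using that k unfolding B_def by (meson not_le)
    qed
    then have "?T \<omega> = (\<Sum>t<n. if t < k then d t \<omega> else 0)" by (simp add: c_def)
    also have "\<dots> = (\<Sum>t<k. d t \<omega>)"
      using kn by (intro sum.mono_neutral_cong_right) auto
    finally show ?thesis using k \<epsilon> by (metis abs_of_pos power2_le_iff_abs_le power2_abs abs_le_square_iff)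
  qed
  have [measurable]: "?T \<in> borel_measurable M" by measurable
  have "prob {\<omega> \<in> space M. \<exists>k\<le>n. \<epsilon> \<le> \<bar>\<Sum>t<k. d t \<omega>\<bar>} \<le> prob {\<omega> \<in> space M. \<epsilon>\<^sup>2 \<le> (?T \<omega>)\<^sup>2}"
    using stop by (intro finite_measure_mono) auto
  also have "\<dots> \<le> (\<integral>\<omega>. (?T \<omega>)\<^sup>2 \<partial>M) / \<epsilon>\<^sup>2"
    using c.second_moment_sum[of n] \<epsilon>
    by (intro integral_Markov_inequality_measure[where A = "{}"]) auto
  also have "\<dots> \<le> (\<Sum>t<n. \<integral>\<omega>. (d t \<omega>)\<^sup>2 \<partial>M) / \<epsilon>\<^sup>2"
    using c.second_moment_sum[of n] le sq d_square
    by (auto intro!: divide_right_mono sum_mono integral_mono)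
  finally show ?thesis .
qed

text \<open>The finite-horizon events increase with the horizon, so continuity from below carries
  over the bound by the full series.\<close>

lemma maximal_inequality_infinite:
  assumes \<epsilon>: "\<epsilon> > 0" and sum: "summable (\<lambda>t. \<integral>\<omega>. (d t \<omega>)\<^sup>2 \<partial>M)"
  shows "prob {\<omega> \<in> space M. \<exists>k. \<epsilon> \<le> \<bar>\<Sum>t<k. d t \<omega>\<bar>} \<le> (\<Sum>t. \<integral>\<omega>. (d t \<omega>)\<^sup>2 \<partial>M) / \<epsilon>\<^sup>2"
proof -
  let ?A = "\<lambda>n. {\<omega> \<in> space M. \<exists>k\<le>n. \<epsilon> \<le> \<bar>\<Sum>t<k. d t \<omega>\<bar>}"
  have "?A n \<in> events" for n by measurable
  then have "(\<lambda>n. prob (?A n)) \<longlonglongrightarrow> prob (\<Union>n. ?A n)"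
    by (intro finite_Lim_measure_incseq) (auto simp: incseq_def intro: order_trans)
  also have "(\<Union>n. ?A n) = {\<omega> \<in> space M. \<exists>k. \<epsilon> \<le> \<bar>\<Sum>t<k. d t \<omega>\<bar>}" by auto
  finally show ?thesis
  proof (rule LIMSEQ_le_const2, intro exI allI impI)
    fix n
    have "prob (?A n) \<le> (\<Sum>t<n. \<integral>\<omega>. (d t \<omega>)\<^sup>2 \<partial>M) / \<epsilon>\<^sup>2" by (rule maximal_inequality[OF \<epsilon>])
    also have "\<dots> \<le> (\<Sum>t. \<integral>\<omega>. (d t \<omega>)\<^sup>2 \<partial>M) / \<epsilon>\<^sup>2"
      using sum by (intro divide_right_mono sum_le_suminf) auto
    finally show "prob (?A n) \<le> (\<Sum>t. \<integral>\<omega>. (d t \<omega>)\<^sup>2 \<partial>M) / \<epsilon>\<^sup>2" .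
  qed
qed

text \<open>An oscillation of size \<open>\<epsilon>\<close> after time m has probability at most
  the tail of the variance series divided by the square of \<open>\<epsilon>\<close>. Hence
  oscillations that persist for every m form a null set, and outside these sets the partial sums are
  Cauchy.\<close>

theorem sums_converge_AE:
  assumes sum: "summable (\<lambda>t. \<integral>\<omega>. (d t \<omega>)\<^sup>2 \<partial>M)"
  shows "AE \<omega> in M. convergent (\<lambda>n. \<Sum>t<n. d t \<omega>)"
proof -
  let ?q = "\<lambda>t. \<integral>\<omega>. (d t \<omega>)\<^sup>2 \<partial>M"
  define A where "A = (\<lambda>\<epsilon> m. {\<omega> \<in> space M. \<exists>k. \<epsilon> \<le> \<bar>\<Sum>t<k. d (m + t) \<omega>\<bar>})"
  have A[measurable]: "A \<epsilon> m \<in> events" for \<epsilon> m unfolding A_def by measurable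
  have "AE \<omega> in M. \<omega> \<notin> (\<Inter>m. A \<epsilon> m)" if \<epsilon>: "\<epsilon> > 0" for \<epsilon>
  proof (rule AE_not_in)
    have "(\<lambda>m. (\<Sum>t. ?q (m + t)) / \<epsilon>\<^sup>2) \<longlonglongrightarrow> 0 / \<epsilon>\<^sup>2"
      using suminf_exist_split2[OF sum] \<epsilon> by (intro tendsto_divide tendsto_const) (auto simp: add.commute)
    moreover have "prob (\<Inter>m. A \<epsilon> m) \<le> (\<Sum>t. ?q (m + t)) / \<epsilon>\<^sup>2" for m
    proof -
      interpret s: martingale_differences M "\<lambda>t. F (m + t)" "\<lambda>t. d (m + t)" by (rule shifted)
      have "summable (\<lambda>t. ?q (m + t))" using summable_ignore_initial_segment[OF sum, of m] by (simp add: add.commute)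
      from s.maximal_inequality_infinite[OF \<epsilon> this]
      have "prob (A \<epsilon> m) \<le> (\<Sum>t. ?q (m + t)) / \<epsilon>\<^sup>2" by (simp add: A_def)
      moreover have "prob (\<Inter>m. A \<epsilon> m) \<le> prob (A \<epsilon> m)" by (intro finite_measure_mono) auto
      ultimately show ?thesis by linarith
    qed
    ultimately have "prob (\<Inter>m. A \<epsilon> m) \<le> 0"
      by (intro LIMSEQ_le_const[where X = "\<lambda>m. (\<Sum>t. ?q (m + t)) / \<epsilon>\<^sup>2"]) auto
    then have "prob (\<Inter>m. A \<epsilon> m) = 0" by (simp add: measure_le_0_iff)
    then show "(\<Inter>m. A \<epsilon> m) \<in> null_sets M"
      by (intro null_setsI) (auto simp: emeasure_eq_measure)
  qed
  \<comment> \<open>Countably many thresholds suffice, which yields a single exceptional null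
    set.\<close>
  then have "AE \<omega> in M. \<forall>j. \<omega> \<notin> (\<Inter>m. A (1 / Suc j) m)" by (subst AE_all_countable) auto
  with AE_space show ?thesis
  proof eventually_elim
    case (elim \<omega>)
    have "Cauchy (\<lambda>n. \<Sum>t<n. d t \<omega>)"
    proof (rule metric_CauchyI)
      fix e :: real assume "e > 0"
      then obtain j where j: "1 / Suc j < e / 2" using nat_approx_posE[of "e/2"] by (auto simp: field_simps)
      with elim obtain m where m: "\<And>k. \<bar>\<Sum>t<k. d (m + t) \<omega>\<bar> < 1 / Suc j"
        by (auto simp: A_def not_le)
      have *: "\<bar>(\<Sum>t<n. d t \<omega>) - (\<Sum>t<m. d t \<omega>)\<bar> < e / 2" if n: "n \<ge> m" for n
      proof -
        have "(\<Sum>t<n. d t \<omega>) - (\<Sum>t<m. d t \<omega>) = (\<Sum>t=m..<n. d t \<omega>)"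
          using n sum_diff_nat_ivl[of 0 m n "\<lambda>t. d t \<omega>"] by (simp add: lessThan_atLeast0)
        also have "\<dots> = (\<Sum>t<n-m. d (m + t) \<omega>)"
          using sum.shift_bounds_nat_ivl[of "\<lambda>t. d t \<omega>" 0 m "n - m"] n
          by (simp add: lessThan_atLeast0 add.commute)
        finally show ?thesis using m[of "n - m"] j by simp
      qed
      show "\<exists>m. \<forall>a\<ge>m. \<forall>b\<ge>m. dist (\<Sum>t<a. d t \<omega>) (\<Sum>t<b. d t \<omega>) < e"
      proof (intro exI allI impI)
        fix a b assume "m \<le> a" "m \<le> b"
        with *[of a] *[of b] show "dist (\<Sum>t<a. d t \<omega>) (\<Sum>t<b. d t \<omega>) < e"
          unfolding dist_real_def by linarith
      qed
    qed
    then show ?case by (rule Cauchy_convergent)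
  qed
qed

end

section \<open>Kernel smoothing of Hoelder continuous densities\<close>

text \<open>The exceptional set of the Hoelder condition lives in the second coordinate alone; its
  cylinder over the first factor is again null.\<close>

lemma (in pair_sigma_finite) AE_pair_snd:
  assumes "AE v in M2. P v"
  shows "AE p in M1 \<Otimes>\<^sub>M M2. P (snd p)"
proof -
  obtain Z where Z: "Z \<in> sets M2" "emeasure M2 Z = 0" "{v \<in> space M2. \<not> P v} \<subseteq> Z"
    using assms unfolding eventually_ae_filter by auto
  show ?thesis
  proof (rule AE_I)
    show "{p \<in> space (M1 \<Otimes>\<^sub>M M2). \<not> P (snd p)} \<subseteq> space M1 \<times> Z"
      using Z by (auto simp: space_pair_measure)
  qed (use Z in \<open>auto simp: M2.emeasure_pair_measure_Times\<close>)
qed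

lemma (in pair_sigma_finite) integrable_scaleR_product:
  fixes f :: "'a \<Rightarrow> real" and h :: "'b \<Rightarrow> 'c::{banach, second_countable_topology}"
  assumes f: "integrable M1 f" and h: "integrable M2 h"
  shows "integrable (M1 \<Otimes>\<^sub>M M2) (\<lambda>(u, v). f u *\<^sub>R h v)"
    and "(\<integral>p. (case p of (u, v) \<Rightarrow> f u *\<^sub>R h v) \<partial>(M1 \<Otimes>\<^sub>M M2)) = (\<integral>u. f u \<partial>M1) *\<^sub>R (\<integral>v. h v \<partial>M2)"
proof -
  have [measurable]: "f \<in> borel_measurable M1" "h \<in> borel_measurable M2" using f h by auto
  show int: "integrable (M1 \<Otimes>\<^sub>M M2) (\<lambda>(u, v). f u *\<^sub>R h v)"
    by (rule Fubini_integrable) (use f h in auto)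
  show "(\<integral>p. (case p of (u, v) \<Rightarrow> f u *\<^sub>R h v) \<partial>(M1 \<Otimes>\<^sub>M M2)) = (\<integral>u. f u \<partial>M1) *\<^sub>R (\<integral>v. h v \<partial>M2)"
    using integral_fst[OF int] f h by simp
qed

text \<open>Affine substitution u = x + c w: the Jacobian cancels the normalising divisor.\<close>

lemma lborel_rescale:
  fixes f :: "real^'r \<Rightarrow> real"
  assumes c: "c > 0" and f: "integrable lborel f"
  shows "integrable lborel (\<lambda>u. f ((u - x) /\<^sub>R c) / c ^ CARD('r))"
    and "(\<integral>u. f ((u - x) /\<^sub>R c) / c ^ CARD('r) \<partial>lborel) = (\<integral>u. f u \<partial>lborel)"
proof -
  let ?h = "\<lambda>u. f ((u - x) /\<^sub>R c) / c ^ CARD('r)"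
  have [measurable]: "f \<in> borel_measurable borel" using borel_measurable_integrable[OF f] by simp
  have eq: "(lborel :: (real^'r) measure) = density (distr lborel borel (\<lambda>w. x + c *\<^sub>R w)) (\<lambda>_. ennreal (c ^ CARD('r)))"
    using lborel_affine[of c x] c by (simp add: DIM_cart)
  have canc: "c ^ CARD('r) *\<^sub>R ?h (x + c *\<^sub>R w) = f w" for w using c by simp
  show "integrable lborel ?h"
    using c f canc by (subst eq) (simp add: integrable_density integrable_distr_eq)
  show "(\<integral>u. ?h u \<partial>lborel) = (\<integral>u. f u \<partial>lborel)"
    using c canc by (subst eq) (simp add: integral_density integral_distr)
qed

text \<open>The factor theta^(-r) of the direction is absorbed here, so that the direction becomes a
  plain average over the batch and the kernel an approximate identity at x.\<close>

definition scaled_kernel :: "(real^'r \<Rightarrow> real) \<Rightarrow> real^'r \<Rightarrow> real \<Rightarrow> real^'r \<Rightarrow> real" where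
  "scaled_kernel K x \<theta> u = K ((u - x) /\<^sub>R \<theta>) / \<theta> ^ CARD('r)"

text \<open>Homogeneity of the norm produces the factor \<open>\<theta> powr \<nu>\<close>, the rate
  of the smoothing bias. The last claim identifies the kernel mass on \<open>X\<close> with the
  integral in \<open>window_retained\<close>.\<close>

lemma scaled_kernel_integrals:
  fixes K :: "real^'r \<Rightarrow> real"
  assumes \<theta>: "\<theta> > 0" and K: "integrable lborel K"
    and K\<nu>: "integrable lborel (\<lambda>w. norm w powr \<nu> * K w)"
    and X: "X \<in> sets borel"
  shows "integrable lborel (scaled_kernel K x \<theta>)"
    and "integrable lborel (\<lambda>u. scaled_kernel K x \<theta> u * norm (u - x) powr \<nu>)"
    and "(\<integral>u. scaled_kernel K x \<theta> u * norm (u - x) powr \<nu> \<partial>lborel) =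
           \<theta> powr \<nu> * (\<integral>w. norm w powr \<nu> * K w \<partial>lborel)"
    and "(LINT u:X|lborel. scaled_kernel K x \<theta> u) = (LINT u:{u. x + \<theta> *\<^sub>R u \<in> X}|lborel. K u)"
proof -
  let ?k = "scaled_kernel K x \<theta>"
  show "integrable lborel ?k"
    using lborel_rescale(1)[OF \<theta> K] by (simp add: scaled_kernel_def[abs_def])
  have eq: "?k u * norm (u - x) powr \<nu> =
      \<theta> powr \<nu> * (norm ((u - x) /\<^sub>R \<theta>) powr \<nu> * K ((u - x) /\<^sub>R \<theta>)) / \<theta> ^ CARD('r)" for u
    using \<theta> by (simp add: scaled_kernel_def powr_mult powr_divide divide_inverse[symmetric] mult.commute[of "inverse _"])
  have K\<nu>': "integrable lborel (\<lambda>w. \<theta> powr \<nu> * (norm w powr \<nu> * K w))" using K\<nu> by simp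
  show "integrable lborel (\<lambda>u. ?k u * norm (u - x) powr \<nu>)"
    unfolding eq by (rule lborel_rescale(1)[OF \<theta> K\<nu>'])
  show "(\<integral>u. ?k u * norm (u - x) powr \<nu> \<partial>lborel) = \<theta> powr \<nu> * (\<integral>w. norm w powr \<nu> * K w \<partial>lborel)"
    unfolding eq using lborel_rescale(2)[OF \<theta> K\<nu>'] by simp
  let ?A = "{u. x + \<theta> *\<^sub>R u \<in> X}"
  have "(\<lambda>u. x + \<theta> *\<^sub>R u) -` X \<inter> space borel \<in> sets borel"
    by (rule measurable_sets[OF _ X]) measurable
  then have A: "?A \<in> sets lborel" by (simp add: vimage_def)
  have int: "integrable lborel (\<lambda>w. indicator ?A w * K w)"
    using integrable_mult_indicator[OF A K] by simp
  have eq2: "indicator X u * ?k u = indicator ?A ((u - x) /\<^sub>R \<theta>) * K ((u - x) /\<^sub>R \<theta>) / \<theta> ^ CARD('r)" for u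
    using \<theta> by (simp add: scaled_kernel_def indicator_def)
  show "(LINT u:X|lborel. ?k u) = (LINT u:?A|lborel. K u)"
    unfolding set_lebesgue_integral_def real_scaleR_def eq2
    by (rule lborel_rescale(2)[OF \<theta> int])
qed

lemma kernel_smoothing:
  fixes X :: "(real^'r) set" and Y :: "(real^'m) set" and k :: "real^'r \<Rightarrow> real"
    and \<phi> :: "real^'m \<Rightarrow> 'b::{banach, second_countable_topology}"
  assumes X[measurable]: "X \<in> sets borel" and Y[measurable]: "Y \<in> sets borel"
    and dens: "density_on X Y g" and samp: "sampled_from M X Y g xo yo"
    and x: "x \<in> X"
    and hoelder: "AE v in lborel. v \<in> Y \<longrightarrow> (\<forall>u\<in>X. \<bar>g u v - g x v\<bar> \<le> \<Lambda> v * norm (u - x) powr \<nu>)"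
    and \<Lambda>0: "\<And>v. 0 \<le> \<Lambda> v"
    and \<phi>[measurable]: "\<phi> \<in> borel_measurable borel"
    and \<phi>\<Lambda>: "set_integrable lborel Y (\<lambda>v. norm (\<phi> v) * \<Lambda> v)"
    and \<phi>g: "set_integrable lborel Y (\<lambda>v. g x v *\<^sub>R \<phi> v)"
    and k0: "\<And>u. 0 \<le> k u" and k: "integrable lborel k"
    and k\<nu>: "integrable lborel (\<lambda>u. k u * norm (u - x) powr \<nu>)"
  shows "integrable M (\<lambda>\<omega>. k (xo \<omega>) *\<^sub>R \<phi> (yo \<omega>))"
    and "norm ((\<integral>\<omega>. k (xo \<omega>) *\<^sub>R \<phi> (yo \<omega>) \<partial>M) - (LINT u:X|lborel. k u) *\<^sub>R (LINT v:Y|lborel. g x v *\<^sub>R \<phi> v))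
           \<le> (\<integral>u. k u * norm (u - x) powr \<nu> \<partial>lborel) * (LINT v:Y|lborel. norm (\<phi> v) * \<Lambda> v)"
proof -
  define G where "G = (\<lambda>p. indicator (X \<times> Y) p * (case p of (u, v) \<Rightarrow> g u v))"
  have [measurable]: "k \<in> borel_measurable borel" using borel_measurable_integrable[OF k] by simp
  have G[measurable]: "G \<in> borel_measurable borel"
    using dens by (simp add: density_on_def set_borel_measurable_def G_def)
  have G0: "0 \<le> G p" for p using dens by (auto simp: density_on_def G_def indicator_def)
  have XY: "indicator (X \<times> Y) (u, v) = (indicator X u * indicator Y v :: real)" for u v
    by (simp add: indicator_def)
  note pair_eq = lborel_prod[where 'a = "real^'r" and 'b = "real^'m"]
  note borel_eq = borel_prod[where 'a = "real^'r" and 'b = "real^'m"]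
  define h where "h = (\<lambda>p. k (fst p) *\<^sub>R \<phi> (snd p))"
  have h[measurable]: "h \<in> borel_measurable borel"
    unfolding h_def borel_eq[symmetric] by measurable
  define F where "F = (\<lambda>p. G p *\<^sub>R h p)"
  define F0 where "F0 = (\<lambda>p::(real^'r) \<times> (real^'m).
    (indicator X (fst p) * k (fst p)) *\<^sub>R (indicator Y (snd p) *\<^sub>R g x (snd p) *\<^sub>R \<phi> (snd p)))"
  define bnd where "bnd = (\<lambda>p::(real^'r) \<times> (real^'m).
    (k (fst p) * norm (fst p - x) powr \<nu>) *\<^sub>R (indicator Y (snd p) * (norm (\<phi> (snd p)) * \<Lambda> (snd p))))"
  have kX: "integrable lborel (\<lambda>u. indicator X u * k u)"
    using integrable_mult_indicator[of X lborel k] k by simp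
  have F0: "integrable lborel F0"
    and F0_int: "(\<integral>p. F0 p \<partial>lborel) = (LINT u:X|lborel. k u) *\<^sub>R (LINT v:Y|lborel. g x v *\<^sub>R \<phi> v)"
    using lborel_pair.integrable_scaleR_product[OF kX \<phi>g[unfolded set_integrable_def]]
    unfolding pair_eq by (simp_all add: F0_def case_prod_unfold set_lebesgue_integral_def)
  have bnd: "integrable lborel bnd"
    and bnd_int: "(\<integral>p. bnd p \<partial>lborel) = (\<integral>u. k u * norm (u - x) powr \<nu> \<partial>lborel) * (LINT v:Y|lborel. norm (\<phi> v) * \<Lambda> v)"
    using lborel_pair.integrable_scaleR_product[OF k\<nu> \<phi>\<Lambda>[unfolded set_integrable_def]]
    unfolding pair_eq by (simp_all add: bnd_def case_prod_unfold set_lebesgue_integral_def)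
  have [measurable]: "F \<in> borel_measurable lborel" "F0 \<in> borel_measurable lborel"
    using borel_measurable_integrable[OF F0] by (auto simp: F_def)
  have "AE p in (lborel :: (real^'r) measure) \<Otimes>\<^sub>M (lborel :: (real^'m) measure). snd p \<in> Y \<longrightarrow>
      (\<forall>u\<in>X. \<bar>g u (snd p) - g x (snd p)\<bar> \<le> \<Lambda> (snd p) * norm (u - x) powr \<nu>)"
    by (rule lborel_pair.AE_pair_snd[OF hoelder])
  then have le: "AE p in lborel. norm (F p - F0 p) \<le> bnd p"
    unfolding pair_eq
  proof eventually_elim
    case (elim p)
    obtain u v where p: "p = (u, v)" by (cases p)
    show ?case
    proof (cases "u \<in> X \<and> v \<in> Y")
      case True
      then have "F p - F0 p = (k u * (g u v - g x v)) *\<^sub>R \<phi> v"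
        by (simp add: F_def F0_def G_def h_def p XY algebra_simps)
      also have "norm \<dots> = k u * norm (\<phi> v) * \<bar>g u v - g x v\<bar>"
        by (simp add: abs_mult k0 mult_ac)
      also have "\<dots> \<le> k u * norm (\<phi> v) * (\<Lambda> v * norm (u - x) powr \<nu>)"
        using elim True k0 by (intro mult_left_mono) (auto simp: p)
      finally show ?thesis using True by (simp add: bnd_def p mult_ac)
    next
      case False
      then have "F p - F0 p = 0" by (auto simp: F_def F0_def G_def p XY)
      then show ?thesis using k0 \<Lambda>0 by (simp add: bnd_def)
    qed
  qed
  have diff: "integrable lborel (\<lambda>p. F p - F0 p)"
    by (rule Bochner_Integration.integrable_bound[OF bnd]) (use le in \<open>auto elim!: eventually_mono\<close>)
  have F: "integrable lborel F"
    using Bochner_Integration.integrable_add[OF diff F0] by simp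
  have D: "distributed M lborel (\<lambda>\<omega>. (xo \<omega>, yo \<omega>)) (\<lambda>p. ennreal (G p))"
    using samp by (simp add: sampled_from_def G_def case_prod_unfold)
  have rv[measurable]: "(\<lambda>\<omega>. (xo \<omega>, yo \<omega>)) \<in> measurable M borel"
    using distributed_measurable[OF D] by simp
  have distr: "distr M borel (\<lambda>\<omega>. (xo \<omega>, yo \<omega>)) = density lborel (\<lambda>p. ennreal (G p))"
    using distributed_distr_eq_density[OF D] by (simp cong: distr_cong)
  have "integrable (distr M borel (\<lambda>\<omega>. (xo \<omega>, yo \<omega>))) h"
    unfolding distr using F G0 by (subst integrable_density) (auto simp: F_def)
  then show "integrable M (\<lambda>\<omega>. k (xo \<omega>) *\<^sub>R \<phi> (yo \<omega>))"
    by (subst (asm) integrable_distr_eq[OF rv h]) (simp add: h_def)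
  have "(\<integral>\<omega>. k (xo \<omega>) *\<^sub>R \<phi> (yo \<omega>) \<partial>M) = (\<integral>p. h p \<partial>distr M borel (\<lambda>\<omega>. (xo \<omega>, yo \<omega>)))"
    by (subst integral_distr[OF rv h]) (simp add: h_def)
  also have "\<dots> = (\<integral>p. F p \<partial>lborel)"
    unfolding distr using G0 by (subst integral_density) (auto simp: F_def)
  finally have E: "(\<integral>\<omega>. k (xo \<omega>) *\<^sub>R \<phi> (yo \<omega>) \<partial>M) - (\<integral>p. F0 p \<partial>lborel) = (\<integral>p. F p - F0 p \<partial>lborel)"
    using F F0 by simp
  have "norm (\<integral>p. F p - F0 p \<partial>lborel) \<le> (\<integral>p. norm (F p - F0 p) \<partial>lborel)"
    by (rule integral_norm_bound)
  also have "\<dots> \<le> (\<integral>p. bnd p \<partial>lborel)"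
    using le bnd diff by (intro integral_mono_AE) auto
  finally show "norm ((\<integral>\<omega>. k (xo \<omega>) *\<^sub>R \<phi> (yo \<omega>) \<partial>M) - (LINT u:X|lborel. k u) *\<^sub>R (LINT v:Y|lborel. g x v *\<^sub>R \<phi> v))
           \<le> (\<integral>u. k u * norm (u - x) powr \<nu> \<partial>lborel) * (LINT v:Y|lborel. norm (\<phi> v) * \<Lambda> v)"
    using E by (simp add: F0_int bnd_int)
qed

text \<open>Measurability is available only for the density extended by zero, so the section carries
  the indicator of \<open>Y\<close>.\<close>

lemma density_section_measurable:
  assumes "density_on X Y g" and x: "x \<in> X"
  shows "(\<lambda>v. indicator Y v * g x v) \<in> borel_measurable borel"
proof -
  have "(\<lambda>p. indicator (X \<times> Y) p * (case p of (u, v) \<Rightarrow> g u v)) \<in> borel_measurable borel"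
    using assms(1) by (simp add: density_on_def set_borel_measurable_def)
  moreover have "Pair x \<in> borel_measurable borel"
    by (intro borel_measurable_continuous_onI continuous_intros)
  ultimately have "(\<lambda>v. indicator (X \<times> Y) (x, v) * (case (x, v) of (u, v) \<Rightarrow> g u v)) \<in> borel_measurable borel"
    by (rule measurable_compose[rotated])
  then show ?thesis using x by (simp add: indicator_def)
qed

text \<open>The bound on the moments of the second marginal controls only averages of \<open>g\<close> over the first
  argument; Hoelder continuity transfers it to the section at the single point \<open>x\<close>.\<close>

lemma section_moment_bound:
  fixes X :: "(real^'r) set" and Y :: "(real^'m) set" and \<phi> :: "real^'m \<Rightarrow> real"
  assumes X: "X \<in> sets borel" and Y[measurable]: "Y \<in> sets borel"
    and dens: "density_on X Y g" and x: "x \<in> X"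
    and hoelder: "AE v in lborel. v \<in> Y \<longrightarrow> (\<forall>u\<in>X. \<bar>g u v - g x v\<bar> \<le> \<Lambda> v * norm (u - x) powr \<nu>)"
    and \<Lambda>0: "\<And>v. 0 \<le> \<Lambda> v" and \<nu>: "0 \<le> \<nu>"
    and \<phi>[measurable]: "\<phi> \<in> borel_measurable borel" and \<phi>0: "\<And>v. 0 \<le> \<phi> v"
    and \<phi>m: "set_integrable lborel Y (\<lambda>v. \<phi> v * marginal2 X g v)"
    and \<phi>\<Lambda>: "set_integrable lborel Y (\<lambda>v. \<phi> v * \<Lambda> v)"
    and B: "B \<in> sets borel" "B \<subseteq> X" "emeasure lborel B < \<infinity>" "0 < measure lborel B"
    and R: "\<And>u. u \<in> B \<Longrightarrow> norm (u - x) \<le> R"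
  shows "set_integrable lborel Y (\<lambda>v. \<phi> v * g x v)"
    and "(LINT v:Y|lborel. \<phi> v * g x v) \<le>
      (LINT v:Y|lborel. \<phi> v * marginal2 X g v) / measure lborel B + R powr \<nu> * (LINT v:Y|lborel. \<phi> v * \<Lambda> v)"
proof -
  let ?\<mu> = "measure lborel B"
  define G where "G = (\<lambda>u v. indicator (X \<times> Y) (u, v) * g u v)"
  have "integrable (lborel \<Otimes>\<^sub>M lborel) (case_prod G)"
    using dens unfolding lborel_prod by (simp add: density_on_def set_integrable_def G_def case_prod_unfold)
  \<comment> \<open>Integrability of the sections must be secured first: for a non-integrable one
    \<open>marginal2 X g v\<close> would be the default value 0 and bound nothing.\<close>
  from lborel_pair.AE_integrable_snd[OF this] hoelder
  have pt: "AE v in lborel. v \<in> Y \<longrightarrow> g x v \<le> marginal2 X g v / ?\<mu> + R powr \<nu> * \<Lambda> v"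
  proof eventually_elim
    case (elim v)
    show ?case
    proof
      assume v: "v \<in> Y"
      have gX: "integrable lborel (\<lambda>u. indicator X u * g u v)"
        using elim(1) v by (simp add: G_def indicator_def if_distrib cong: if_cong)
      have "integrable lborel (\<lambda>u. indicator B u *\<^sub>R (indicator X u * g u v))"
        using B by (intro integrable_mult_indicator gX) auto
      moreover have "indicator B u *\<^sub>R (indicator X u * g u v) = indicator B u * g u v" for u
        using B(2) by (auto simp: indicator_def)
      ultimately have gB: "integrable lborel (\<lambda>u. indicator B u * g u v)" by (simp only:)
      have const: "integrable lborel (\<lambda>u. indicator B u * c)" for c :: real
        using B by (simp add: less_top[symmetric])
      \<comment> \<open>The Hoelder bound is averaged over \<open>B\<close>; afterwards
        nonnegativity of the density allows \<open>B\<close> to be enlarged to \<open>X\<close>,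
        which brings in the marginal.\<close>
      have "?\<mu> * g x v = (\<integral>u. indicator B u * g x v \<partial>lborel)" using B by simp
      also have "\<dots> \<le> (\<integral>u. indicator B u * g u v + indicator B u * (\<Lambda> v * R powr \<nu>) \<partial>lborel)"
      proof (rule integral_mono[OF const])
        show "integrable lborel (\<lambda>u. indicator B u * g u v + indicator B u * (\<Lambda> v * R powr \<nu>))"
          using gB const by (rule Bochner_Integration.integrable_add)
        fix u
        show "indicator B u * g x v \<le> indicator B u * g u v + indicator B u * (\<Lambda> v * R powr \<nu>)"
        proof (cases "u \<in> B")
          case True
          have "\<bar>g u v - g x v\<bar> \<le> \<Lambda> v * norm (u - x) powr \<nu>" using elim(2) v True B by auto
          also have "\<dots> \<le> \<Lambda> v * R powr \<nu>"
            using R[OF True] \<Lambda>0 \<nu> by (intro mult_left_mono powr_mono2) auto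
          finally show ?thesis using True by simp
        qed simp
      qed
      also have "\<dots> = (\<integral>u. indicator B u * g u v \<partial>lborel) + ?\<mu> * (\<Lambda> v * R powr \<nu>)"
        using gB const B by simp
      also have "(\<integral>u. indicator B u * g u v \<partial>lborel) \<le> (\<integral>u. indicator X u * g u v \<partial>lborel)"
        using gB gX B dens v by (intro integral_mono) (auto simp: indicator_def density_on_def)
      finally show "g x v \<le> marginal2 X g v / ?\<mu> + R powr \<nu> * \<Lambda> v"
        using B(4) by (simp add: marginal2_def set_lebesgue_integral_def field_simps)
    qed
  qed
  let ?h = "\<lambda>v. (indicator Y v * (\<phi> v * marginal2 X g v)) / ?\<mu> + R powr \<nu> * (indicator Y v * (\<phi> v * \<Lambda> v))"
  have h: "integrable lborel ?h"
    using \<phi>m \<phi>\<Lambda> by (simp add: set_integrable_def)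
  have [measurable]: "(\<lambda>v. indicator Y v * g x v) \<in> borel_measurable borel"
    by (rule density_section_measurable[OF dens x])
  have "(\<lambda>v. \<phi> v * (indicator Y v * g x v)) \<in> borel_measurable borel" by measurable
  then have meas: "(\<lambda>v. indicator Y v * (\<phi> v * g x v)) \<in> borel_measurable lborel"
    by (simp add: mult_ac)
  have g0: "0 \<le> g x v" if "v \<in> Y" for v using dens x that by (auto simp: density_on_def)
  have le: "AE v in lborel. indicator Y v * (\<phi> v * g x v) \<le> ?h v"
    using pt
  proof eventually_elim
    case (elim v)
    then show ?case
      using mult_left_mono[OF _ \<phi>0[of v], of "g x v" "marginal2 X g v / ?\<mu> + R powr \<nu> * \<Lambda> v"]
      by (cases "v \<in> Y") (auto simp: algebra_simps)
  qed
  show int: "set_integrable lborel Y (\<lambda>v. \<phi> v * g x v)"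
    unfolding set_integrable_def real_scaleR_def
    by (rule Bochner_Integration.integrable_bound[OF h meas])
      (use le in eventually_elim, use \<phi>0 g0 in \<open>auto simp: indicator_def\<close>)
  have "(LINT v:Y|lborel. \<phi> v * g x v) \<le> (\<integral>v. ?h v \<partial>lborel)"
    unfolding set_lebesgue_integral_def real_scaleR_def
    by (rule integral_mono_AE[OF _ h le]) (use int in \<open>simp add: set_integrable_def\<close>)
  also have "\<dots> = (LINT v:Y|lborel. \<phi> v * marginal2 X g v) / ?\<mu> + R powr \<nu> * (LINT v:Y|lborel. \<phi> v * \<Lambda> v)"
    using \<phi>m \<phi>\<Lambda> by (simp add: set_integrable_def set_lebesgue_integral_def)
  finally show "(LINT v:Y|lborel. \<phi> v * g x v) \<le>
      (LINT v:Y|lborel. \<phi> v * marginal2 X g v) / ?\<mu> + R powr \<nu> * (LINT v:Y|lborel. \<phi> v * \<Lambda> v)" .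
qed

section \<open>Projected stochastic descent with independent observations\<close>

text \<open>By Tonelli the random series has finite integral, so it is finite almost
  everywhere.\<close>

lemma AE_summable_of_summable_integrals:
  fixes f :: "nat \<Rightarrow> 'a \<Rightarrow> real"
  assumes f: "\<And>t. integrable M (f t)" and f0: "\<And>t \<omega>. 0 \<le> f t \<omega>"
    and sum: "summable (\<lambda>t. \<integral>\<omega>. f t \<omega> \<partial>M)"
  shows "AE \<omega> in M. summable (\<lambda>t. f t \<omega>)"
proof -
  have [measurable]: "f t \<in> borel_measurable M" for t using f by auto
  have "(\<integral>\<^sup>+\<omega>. (\<Sum>t. ennreal (f t \<omega>)) \<partial>M) = (\<Sum>t. \<integral>\<^sup>+\<omega>. ennreal (f t \<omega>) \<partial>M)"
    by (rule nn_integral_suminf) simp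
  also have "\<dots> = (\<Sum>t. ennreal (\<integral>\<omega>. f t \<omega> \<partial>M))"
    using f f0 by (simp add: nn_integral_eq_integral)
  also have "\<dots> = ennreal (\<Sum>t. \<integral>\<omega>. f t \<omega> \<partial>M)"
    using sum f0 by (intro suminf_ennreal2) auto
  finally have "(\<integral>\<^sup>+\<omega>. (\<Sum>t. ennreal (f t \<omega>)) \<partial>M) \<noteq> \<infinity>" by simp
  then have "AE \<omega> in M. (\<Sum>t. ennreal (f t \<omega>)) \<noteq> \<infinity>"
    by (intro nn_integral_PInf_AE) auto
  then show ?thesis
    by eventually_elim (auto intro: summable_suminf_not_top f0)
qed

text \<open>Jensen's inequality for the squared norm; it makes the second moment bound of the
  direction uniform in the batch size.\<close>

lemma norm_square_average_le:
  fixes v :: "nat \<Rightarrow> 'a::real_normed_vector"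
  assumes n: "1 \<le> n"
  shows "(norm ((1 / real n) *\<^sub>R (\<Sum>i=1..n. v i)))\<^sup>2 \<le> (1 / real n) * (\<Sum>i=1..n. (norm (v i))\<^sup>2)"
proof -
  have "(norm (\<Sum>i=1..n. v i))\<^sup>2 \<le> (\<Sum>i=1..n. norm (v i))\<^sup>2"
    by (intro power_mono norm_sum) simp
  also have "\<dots> \<le> (\<Sum>i=1..n. (norm (v i))\<^sup>2) * real (card {1..n})"
    by (rule sum_squared_le_sum_of_squares)
  finally show ?thesis using n by (simp add: power_divide power2_eq_square field_simps)
qed

lemma norm_diff_square_le:
  fixes u v :: "'a::real_inner"
  shows "(norm (u - v))\<^sup>2 \<le> 2 * (norm u)\<^sup>2 + 2 * (norm v)\<^sup>2"
  using zero_le_power2[of "norm (u + v)"]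
  by (simp add: power2_norm_eq_inner inner_simps inner_commute)

text \<open>The probabilistic half of the argument. At a fixed point v the mean direction is
  \<open>a t *\<^sub>R v - b t\<close>, and \<open>bias\<close> says that it is a pull of strength
  \<open>w t\<close> towards the target \<open>ys t\<close> up to \<open>\<epsilon> t\<close>. The
  bound \<open>kb t\<close> on the kernel plays the role of theta^(-r).\<close>

locale projected_regression = prob_space M for M :: "'w measure" +
  fixes C :: "'b::euclidean_space set" and N :: "nat \<Rightarrow> nat"
    and xo :: "nat \<Rightarrow> nat \<Rightarrow> 'w \<Rightarrow> 'a::euclidean_space" and yo :: "nat \<Rightarrow> nat \<Rightarrow> 'w \<Rightarrow> 'b"
    and k :: "nat \<Rightarrow> 'a \<Rightarrow> real" and \<rho> kb a \<epsilon> w \<delta> :: "nat \<Rightarrow> real" and b ys :: "nat \<Rightarrow> 'b"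
    and c1 c2 \<kappa> :: real and z :: "nat \<Rightarrow> 'w \<Rightarrow> 'b" and z0 :: 'b
  assumes C: "convex C" "compact C" and z0: "z0 \<in> C" and ys: "\<And>t. ys t \<in> C"
    and N: "\<And>t. 1 \<le> N t"
    and indep: "indep_vars (\<lambda>_. borel) (\<lambda>(t, i) \<omega>. (xo t i \<omega>, yo t i \<omega>)) (SIGMA t:UNIV. {1..N t})"
    and k_meas[measurable]: "\<And>t. k t \<in> borel_measurable borel"
    and k0: "\<And>t u. 0 \<le> k t u" and kb: "\<And>t u. k t u \<le> kb t"
    and k_int: "\<And>t i. i \<in> {1..N t} \<Longrightarrow> integrable M (\<lambda>\<omega>. k t (xo t i \<omega>))"
    and k_mean: "\<And>t i. i \<in> {1..N t} \<Longrightarrow> (\<integral>\<omega>. k t (xo t i \<omega>) \<partial>M) = a t"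
    and ky_int: "\<And>t i. i \<in> {1..N t} \<Longrightarrow> integrable M (\<lambda>\<omega>. k t (xo t i \<omega>) *\<^sub>R yo t i \<omega>)"
    and ky_mean: "\<And>t i. i \<in> {1..N t} \<Longrightarrow> (\<integral>\<omega>. k t (xo t i \<omega>) *\<^sub>R yo t i \<omega> \<partial>M) = b t"
    and ky2_int: "\<And>t i. i \<in> {1..N t} \<Longrightarrow> integrable M (\<lambda>\<omega>. k t (xo t i \<omega>) * (norm (yo t i \<omega>))\<^sup>2)"
    and a_le: "\<And>t. a t \<le> c1"
    and ky2_le: "\<And>t i. i \<in> {1..N t} \<Longrightarrow> (\<integral>\<omega>. k t (xo t i \<omega>) * (norm (yo t i \<omega>))\<^sup>2 \<partial>M) \<le> c2"
    and bias: "\<And>t v. v \<in> C \<Longrightarrow> norm (a t *\<^sub>R v - b t - w t *\<^sub>R (v - ys t)) \<le> \<epsilon> t"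
    and \<epsilon>: "\<epsilon> \<longlonglongrightarrow> 0" and w: "\<forall>\<^sub>F t in sequentially. \<kappa> \<le> w t" and \<kappa>: "0 < \<kappa>"
    and \<delta>: "\<And>t. norm (ys (Suc t) - ys t) \<le> \<delta> t" and \<delta>\<rho>: "(\<lambda>t. \<delta> t / \<rho> t) \<longlonglongrightarrow> 0"
    and \<rho>: "\<And>t. 0 < \<rho> t" and \<rho>0: "\<rho> \<longlonglongrightarrow> 0"
    and \<rho>_div: "filterlim (\<lambda>n. \<Sum>t<n. \<rho> t) at_top sequentially"
    and \<rho>2: "summable (\<lambda>t. (\<rho> t)\<^sup>2)" and \<rho>2kb: "summable (\<lambda>t. (\<rho> t)\<^sup>2 * kb t)"
    and z_0: "\<And>\<omega>. z 0 \<omega> = z0"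
    and z_Suc: "\<And>t \<omega>. z (Suc t) \<omega> = closest_point C (z t \<omega> - \<rho> t *\<^sub>R
          ((1 / real (N t)) *\<^sub>R (\<Sum>i=1..N t. k t (xo t i \<omega>) *\<^sub>R (z t \<omega> - yo t i \<omega>))))"
begin

section \<open>The filtration generated by the observations\<close>

definition obs :: "nat \<times> nat \<Rightarrow> 'w \<Rightarrow> 'a \<times> 'b" where
  "obs = (\<lambda>(t, i) \<omega>. (xo t i \<omega>, yo t i \<omega>))"

text \<open>These are the families in which \<open>indep_vars_def2\<close> expresses independence;
  they are stable under intersection, as needed for collecting them into blocks.\<close>

definition obs_events :: "nat \<times> nat \<Rightarrow> 'w set set" where
  "obs_events p = {obs p -` A \<inter> space M | A. A \<in> sets borel}"

text \<open>Only times strictly before t count: \<open>z t\<close> is then known to the past, while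
  the batch drawn at time t is independent of it.\<close>

definition past :: "nat \<Rightarrow> 'w measure" where
  "past t = sigma (space M) (\<Union>p\<in>(SIGMA s:{..<t}. {1..N s}). obs_events p)"

lemma indep_obs_events: "indep_sets obs_events (SIGMA t:UNIV. {1..N t})"
  using indep unfolding indep_vars_def2 obs_events_def[abs_def] obs_def[symmetric] by simp

lemma obs_measurable: "i \<in> {1..N t} \<Longrightarrow> obs (t, i) \<in> borel_measurable M"
  using indep unfolding indep_vars_def2 obs_def by auto

lemma obs_events_subset: "obs_events p \<subseteq> Pow (space M)"
  by (auto simp: obs_events_def)

lemma space_past [simp]: "space (past t) = space M"
  by (simp add: past_def space_measure_of_conv)

lemma sets_past: "sets (past t) = sigma_sets (space M) (\<Union>p\<in>(SIGMA s:{..<t}. {1..N s}). obs_events p)"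
  unfolding past_def using obs_events_subset by (intro sets_measure_of) blast

lemma sets_past_subset: "sets (past t) \<subseteq> sets M"
  unfolding sets_past by (intro sets.sigma_sets_subset) (auto simp: obs_events_def intro!: measurable_sets[OF obs_measurable])

lemma sets_past_mono: "s \<le> t \<Longrightarrow> sets (past s) \<subseteq> sets (past t)"
  unfolding sets_past by (intro sigma_sets_mono') force

lemma past_measurable_M: "f \<in> borel_measurable (past t) \<Longrightarrow> f \<in> borel_measurable M"
  using sets_past_subset[of t] by (auto simp: measurable_def)

lemma past_measurable_mono: "s \<le> t \<Longrightarrow> f \<in> borel_measurable (past s) \<Longrightarrow> f \<in> borel_measurable (past t)"
  using sets_past_mono[of s t] by (auto simp: measurable_def)

lemma obs_measurable_past:
  assumes "s < t" "i \<in> {1..N s}"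
  shows "obs (s, i) \<in> borel_measurable (past t)"
proof (rule measurableI)
  fix A :: "('a \<times> 'b) set" assume "A \<in> sets borel"
  then have "obs (s, i) -` A \<inter> space M \<in> obs_events (s, i)" by (auto simp: obs_events_def)
  with assms show "obs (s, i) -` A \<inter> space (past t) \<in> sets (past t)"
    unfolding sets_past space_past by (intro sigma_sets.Basic UN_I[of "(s, i)"]) auto
qed simp

lemma xo_yo_measurable_past:
  assumes "s < t" "i \<in> {1..N s}"
  shows "xo s i \<in> borel_measurable (past t)" "yo s i \<in> borel_measurable (past t)"
proof -
  have "(\<lambda>\<omega>. fst (obs (s, i) \<omega>)) \<in> borel_measurable (past t)" "(\<lambda>\<omega>. snd (obs (s, i) \<omega>)) \<in> borel_measurable (past t)"
    using obs_measurable_past[OF assms] by (auto intro!: borel_measurable_continuous_on[OF _ , of fst] borel_measurable_continuous_on[OF _ , of snd] continuous_intros)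
  then show "xo s i \<in> borel_measurable (past t)" "yo s i \<in> borel_measurable (past t)" by (simp_all add: obs_def)
qed

text \<open>This replaces conditioning on the past. One observation at a time is paired with the
  whole past; sums over a batch are handled later by linearity.\<close>

lemma expectation_past_times_obs:
  fixes f :: "'w \<Rightarrow> real" and h :: "'a \<times> 'b \<Rightarrow> real"
  assumes i: "i \<in> {1..N t}" and f: "f \<in> borel_measurable (past t)" "integrable M f"
    and h[measurable]: "h \<in> borel_measurable borel" and hi: "integrable M (\<lambda>\<omega>. h (obs (t, i) \<omega>))"
  shows "integrable M (\<lambda>\<omega>. f \<omega> * h (obs (t, i) \<omega>))"
    and "(\<integral>\<omega>. f \<omega> * h (obs (t, i) \<omega>) \<partial>M) = (\<integral>\<omega>. f \<omega> \<partial>M) * (\<integral>\<omega>. h (obs (t, i) \<omega>) \<partial>M)"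
proof -
  \<comment> \<open>Two disjoint blocks of indices, the past and the single new observation,
    generate independent sigma-algebras.\<close>
  let ?I = "case_bool (SIGMA s:{..<t}. {1..N s}) {(t, i)}"
  have "indep_sets (\<lambda>j. sigma_sets (space M) (\<Union>p\<in>?I j. obs_events p)) UNIV"
  proof (rule indep_sets_collect_sigma)
    show "indep_sets obs_events (\<Union>j\<in>UNIV. ?I j)"
      by (rule indep_sets_mono_index[OF _ indep_obs_events]) (use i in \<open>auto split: bool.splits\<close>)
    show "Int_stable (obs_events p)" for p
      unfolding obs_events_def
    proof (rule Int_stableI, safe)
      fix A B :: "('a \<times> 'b) set" assume "A \<in> sets borel" "B \<in> sets borel"
      then show "\<exists>Aa. obs p -` A \<inter> space M \<inter> (obs p -` B \<inter> space M) = obs p -` Aa \<inter> space M \<and> Aa \<in> sets borel"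
        by (intro exI[of _ "A \<inter> B"]) auto
    qed
    show "disjoint_family_on ?I UNIV" by (auto simp: disjoint_family_on_def split: bool.splits)
  qed
  then have "indep_sets (case_bool (sets (past t)) (sigma_sets (space M) (obs_events (t, i)))) UNIV"
    by (rule indep_sets_mono_sets) (auto simp: sets_past split: bool.splits)
  then have ind: "indep_set (sigma_sets (space M) {f -` A \<inter> space M | A. A \<in> sets borel})
      (sigma_sets (space M) {(\<lambda>\<omega>. h (obs (t, i) \<omega>)) -` A \<inter> space M | A. A \<in> sets borel})"
    unfolding indep_set_def
  proof (rule indep_sets_mono_sets)
    fix j :: bool
    have "f -` A \<inter> space M \<in> sets (past t)" if "A \<in> sets borel" for A
      using measurable_sets[OF f(1) that] by simp
    then have 1: "sigma_sets (space M) {f -` A \<inter> space M | A. A \<in> sets borel} \<subseteq> sets (past t)"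
      using sets.sigma_sets_subset[of "{f -` A \<inter> space M | A. A \<in> sets borel}" "past t"] by auto
    have 2: "sigma_sets (space M) {(\<lambda>\<omega>. h (obs (t, i) \<omega>)) -` A \<inter> space M | A. A \<in> sets borel}
        \<subseteq> sigma_sets (space M) (obs_events (t, i))"
    proof (rule sigma_sets_mono', safe)
      fix A :: "real set" assume A: "A \<in> sets borel"
      have "h -` A \<in> sets borel" using measurable_sets[OF h A] by simp
      then show "(\<lambda>\<omega>. h (obs (t, i) \<omega>)) -` A \<inter> space M \<in> obs_events (t, i)"
        unfolding obs_events_def by (intro CollectI exI[of _ "h -` A"]) auto
    qed
    show "case_bool (sigma_sets (space M) {f -` A \<inter> space M | A. A \<in> sets borel})
        (sigma_sets (space M) {(\<lambda>\<omega>. h (obs (t, i) \<omega>)) -` A \<inter> space M | A. A \<in> sets borel}) j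
      \<subseteq> case_bool (sets (past t)) (sigma_sets (space M) (obs_events (t, i))) j"
      using 1 2 by (cases j) auto
  qed
  have "indep_var borel f borel (\<lambda>\<omega>. h (obs (t, i) \<omega>))"
    unfolding indep_var_eq using ind f hi by auto
  then show "integrable M (\<lambda>\<omega>. f \<omega> * h (obs (t, i) \<omega>))"
    and "(\<integral>\<omega>. f \<omega> * h (obs (t, i) \<omega>) \<partial>M) = (\<integral>\<omega>. f \<omega> \<partial>M) * (\<integral>\<omega>. h (obs (t, i) \<omega>) \<partial>M)"
    using f(2) hi by (auto intro: indep_var_integrable indep_var_lebesgue_integral)
qed

section \<open>Iterates, noise and second moment bounds\<close>

definition direction :: "nat \<Rightarrow> 'w \<Rightarrow> 'b" where
  "direction t \<omega> = (1 / real (N t)) *\<^sub>R (\<Sum>i=1..N t. k t (xo t i \<omega>) *\<^sub>R (z t \<omega> - yo t i \<omega>))"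

lemma z_in: "z t \<omega> \<in> C"
proof (cases t)
  case (Suc s)
  have "closed C" "C \<noteq> {}" using C z0 by (auto simp: compact_imp_closed)
  then show ?thesis using Suc by (simp add: z_Suc closest_point_in_set)
qed (simp add: z_0 z0)

lemma z_measurable: "z t \<in> borel_measurable (past t)"
proof (induction t)
  case 0
  have "z 0 = (\<lambda>_. z0)" using z_0 by auto
  then show ?case by simp
next
  case (Suc t)
  have [measurable]: "z t \<in> borel_measurable (past (Suc t))"
    by (rule past_measurable_mono[OF _ Suc]) simp
  have [measurable]: "xo t i \<in> borel_measurable (past (Suc t))" "yo t i \<in> borel_measurable (past (Suc t))"
    if "i \<in> {1..N t}" for i
    using xo_yo_measurable_past[of t "Suc t" i] that by auto
  have "closed C" "C \<noteq> {}" using C z0 by (auto simp: compact_imp_closed)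
  then have [measurable]: "closest_point C \<in> borel_measurable borel"
    by (intro borel_measurable_continuous_onI continuous_on_closest_point C)
  have "z (Suc t) = (\<lambda>\<omega>. closest_point C (z t \<omega> - \<rho> t *\<^sub>R
          ((1 / real (N t)) *\<^sub>R (\<Sum>i=1..N t. k t (xo t i \<omega>) *\<^sub>R (z t \<omega> - yo t i \<omega>)))))"
    by (rule ext) (rule z_Suc)
  also have "\<dots> \<in> borel_measurable (past (Suc t))" by measurable
  finally show ?case .
qed

definition noise :: "nat \<Rightarrow> 'w \<Rightarrow> 'b" where
  "noise t \<omega> = direction t \<omega> - (a t *\<^sub>R z t \<omega> - b t)"

text \<open>The noise part of the cross term when the squared distance to the target is expanded
  after one unprojected step.\<close>

definition md :: "nat \<Rightarrow> 'w \<Rightarrow> real" where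
  "md t \<omega> = - 2 * \<rho> t * (noise t \<omega> \<bullet> (z t \<omega> - ys t))"

definition rad :: real where "rad = (SUP v\<in>C. norm v)"

text \<open>A majorant of the squared direction in which the iterate is replaced by the radius of
  \<open>C\<close>. It depends on the current observations only, so its mean follows from their
  moments.\<close>

definition sq_bound :: "nat \<Rightarrow> 'w \<Rightarrow> real" where
  "sq_bound t \<omega> = (1 / real (N t)) * (\<Sum>i=1..N t. kb t * (k t (xo t i \<omega>) *
     (2 * rad\<^sup>2) + 2 * (k t (xo t i \<omega>) * (norm (yo t i \<omega>))\<^sup>2)))"

lemma norm_le_rad: "v \<in> C \<Longrightarrow> norm v \<le> rad"
  unfolding rad_def using compact_imp_bounded[OF C(2)]
  by (intro cSUP_upper) (auto simp: bounded_iff bdd_above_def)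

lemma rad0: "0 \<le> rad"
  using norm_le_rad[OF z0] norm_ge_zero[of z0] by linarith

lemma dist_le_rad: "u \<in> C \<Longrightarrow> v \<in> C \<Longrightarrow> norm (u - v) \<le> 2 * rad"
  using norm_triangle_ineq4[of u v] norm_le_rad[of u] norm_le_rad[of v] by linarith

lemma kb0: "0 \<le> kb t"
  using k0[of t undefined] kb[of t undefined] by linarith

lemma sq_bound_nonneg: "0 \<le> sq_bound t \<omega>"
  unfolding sq_bound_def using kb0 k0 by (intro mult_nonneg_nonneg sum_nonneg add_nonneg_nonneg) auto

lemma direction_square_le: "(norm (direction t \<omega>))\<^sup>2 \<le> sq_bound t \<omega>"
proof -
  have "(norm (direction t \<omega>))\<^sup>2 \<le> (1 / real (N t)) * (\<Sum>i=1..N t. (norm (k t (xo t i \<omega>) *\<^sub>R (z t \<omega> - yo t i \<omega>)))\<^sup>2)"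
    unfolding direction_def by (rule norm_square_average_le[OF N])
  also have "\<dots> \<le> sq_bound t \<omega>"
    unfolding sq_bound_def
  proof (intro mult_left_mono sum_mono)
    fix i
    let ?k = "k t (xo t i \<omega>)" and ?y = "yo t i \<omega>"
    have "(norm (z t \<omega> - ?y))\<^sup>2 \<le> 2 * (norm (z t \<omega>))\<^sup>2 + 2 * (norm ?y)\<^sup>2"
      by (rule norm_diff_square_le)
    also have "\<dots> \<le> 2 * rad\<^sup>2 + 2 * (norm ?y)\<^sup>2"
      using norm_le_rad[OF z_in, of t \<omega>] by (intro add_right_mono mult_left_mono power_mono) auto
    finally have *: "?k * (norm (z t \<omega> - ?y))\<^sup>2 \<le> ?k * (2 * rad\<^sup>2 + 2 * (norm ?y)\<^sup>2)"
      using k0 by (intro mult_left_mono) auto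
    have "(norm (?k *\<^sub>R (z t \<omega> - ?y)))\<^sup>2 = ?k * (?k * (norm (z t \<omega> - ?y))\<^sup>2)"
      using k0 by (simp add: power_mult_distrib power2_eq_square)
    \<comment> \<open>Only one of the two kernel factors is replaced by its supremum; the other
      stays as the weight whose moments are bounded uniformly in t.\<close>
    also have "\<dots> \<le> kb t * (?k * (2 * rad\<^sup>2 + 2 * (norm ?y)\<^sup>2))"
      by (rule mult_mono[OF kb * kb0]) (use k0 in auto)
    finally show "(norm (?k *\<^sub>R (z t \<omega> - ?y)))\<^sup>2 \<le> kb t * (?k * (2 * rad\<^sup>2) + 2 * (?k * (norm ?y)\<^sup>2))"
      by (simp add: algebra_simps)
  qed simp
  finally show ?thesis .
qed

lemma sq_bound_integrable: "integrable M (sq_bound t)"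
  unfolding sq_bound_def[abs_def] using k_int ky2_int by (intro integrable_mult_right Bochner_Integration.integrable_sum) auto

lemma sq_bound_mean: "(\<integral>\<omega>. sq_bound t \<omega> \<partial>M) \<le> kb t * (2 * rad\<^sup>2 * c1 + 2 * c2)"
proof -
  have "(\<integral>\<omega>. sq_bound t \<omega> \<partial>M) = (1 / real (N t)) * (\<Sum>i=1..N t. kb t * (a t * (2 * rad\<^sup>2) + 2 * (\<integral>\<omega>. k t (xo t i \<omega>) * (norm (yo t i \<omega>))\<^sup>2 \<partial>M)))"
    unfolding sq_bound_def using k_int ky2_int
    by (subst integral_mult_right_zero, subst Bochner_Integration.integral_sum)
      (auto simp: k_mean intro!: sum.cong)
  also have "\<dots> \<le> (1 / real (N t)) * (\<Sum>i=1..N t. kb t * (c1 * (2 * rad\<^sup>2) + 2 * c2))"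
    using a_le ky2_le kb0 by (intro mult_left_mono sum_mono add_mono mult_right_mono) auto
  also have "\<dots> = kb t * (2 * rad\<^sup>2 * c1 + 2 * c2)" using N[of t] by (simp add: mult_ac)
  finally show ?thesis .
qed

text \<open>Observation 1 represents its batch, which is nonempty. Its weighted first moment is
  controlled by |y| <= 1 + |y|^2, that is, by \<open>c1 + c2\<close>.\<close>

lemma drift_bounded: obtains m where "\<And>t v. v \<in> C \<Longrightarrow> norm (a t *\<^sub>R v - b t) \<le> m"
proof
  fix t v assume v: "v \<in> C"
  have i: "1 \<in> {1..N t}" using N[of t] by simp
  have a0: "0 \<le> a t" unfolding k_mean[OF i, symmetric] using k0 by simp
  have "norm (b t) \<le> (\<integral>\<omega>. norm (k t (xo t 1 \<omega>) *\<^sub>R yo t 1 \<omega>) \<partial>M)"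
    unfolding ky_mean[OF i, symmetric] by (rule integral_norm_bound)
  also have "\<dots> \<le> (\<integral>\<omega>. k t (xo t 1 \<omega>) + k t (xo t 1 \<omega>) * (norm (yo t 1 \<omega>))\<^sup>2 \<partial>M)"
  proof (rule integral_mono)
    fix \<omega>
    have "norm (yo t 1 \<omega>) \<le> 1 + (norm (yo t 1 \<omega>))\<^sup>2"
      using sum_squares_bound[of 1 "norm (yo t 1 \<omega>)"] norm_ge_zero[of "yo t 1 \<omega>"]
      unfolding mult_1_right power_one by linarith
    from mult_left_mono[OF this k0[of t "xo t 1 \<omega>"]]
    show "norm (k t (xo t 1 \<omega>) *\<^sub>R yo t 1 \<omega>) \<le> k t (xo t 1 \<omega>) + k t (xo t 1 \<omega>) * (norm (yo t 1 \<omega>))\<^sup>2"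
      using k0 by (simp add: algebra_simps)
  qed (use k_int[OF i] ky2_int[OF i] integrable_norm[OF ky_int[OF i]] in auto)
  also have "\<dots> \<le> c1 + c2" using k_int[OF i] ky2_int[OF i] k_mean[OF i] a_le[of t] ky2_le[OF i] by simp
  finally have b: "norm (b t) \<le> c1 + c2" .
  have "norm (a t *\<^sub>R v) \<le> c1 * rad"
    using a0 a_le[of t] norm_le_rad[OF v] rad0 by (auto intro!: mult_mono)
  with b show "norm (a t *\<^sub>R v - b t) \<le> c1 * rad + (c1 + c2)"
    using norm_triangle_ineq4[of "a t *\<^sub>R v" "b t"] by linarith
qed

lemma direction_measurable: "direction t \<in> borel_measurable (past (Suc t))"
proof -
  have [measurable]: "z t \<in> borel_measurable (past (Suc t))"
    by (rule past_measurable_mono[OF _ z_measurable]) simp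
  have [measurable]: "xo t i \<in> borel_measurable (past (Suc t))" "yo t i \<in> borel_measurable (past (Suc t))"
    if "i \<in> {1..N t}" for i
    using xo_yo_measurable_past[of t "Suc t" i] that by auto
  show ?thesis unfolding direction_def[abs_def] by measurable
qed

lemma md_measurable: "md t \<in> borel_measurable (past (Suc t))"
proof -
  have [measurable]: "z t \<in> borel_measurable (past (Suc t))" "direction t \<in> borel_measurable (past (Suc t))"
    using past_measurable_mono[OF _ z_measurable[of t], of "Suc t"] direction_measurable by auto
  show ?thesis unfolding md_def[abs_def] noise_def by measurable
qed

lemma md_square:
  obtains m where "0 \<le> m" "\<And>t \<omega>. (md t \<omega>)\<^sup>2 \<le> m * ((\<rho> t)\<^sup>2 * sq_bound t \<omega> + (\<rho> t)\<^sup>2)"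
proof -
  obtain m where m: "\<And>t v. v \<in> C \<Longrightarrow> norm (a t *\<^sub>R v - b t) \<le> m" using drift_bounded by metis
  \<comment> \<open>The 4 comes from squaring the factor -2 in \<open>md\<close>, and
    \<open>2 * rad\<close> bounds the diameter of \<open>C\<close>. The factor 2 in
    \<open>?m\<close> stems from splitting the noise into direction and mean drift; the maximum
    merges the two coefficients.\<close>
  let ?c = "4 * (2 * rad)\<^sup>2"
  let ?m = "max (2 * ?c) (2 * ?c * m\<^sup>2)"
  show ?thesis
  proof (rule that)
    show "0 \<le> ?m" by (simp add: le_max_iff_disj)
    fix t \<omega>
    have "(norm (noise t \<omega>))\<^sup>2 \<le> 2 * (norm (direction t \<omega>))\<^sup>2 + 2 * (norm (a t *\<^sub>R z t \<omega> - b t))\<^sup>2"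
      unfolding noise_def by (rule norm_diff_square_le)
    also have "\<dots> \<le> 2 * sq_bound t \<omega> + 2 * m\<^sup>2"
      using direction_square_le m[OF z_in] by (intro add_mono mult_left_mono power_mono) auto
    finally have n: "(norm (noise t \<omega>))\<^sup>2 \<le> 2 * sq_bound t \<omega> + 2 * m\<^sup>2" .
    have "(noise t \<omega> \<bullet> (z t \<omega> - ys t))\<^sup>2 \<le> (norm (noise t \<omega>) * norm (z t \<omega> - ys t))\<^sup>2"
      using Cauchy_Schwarz_ineq2[of "noise t \<omega>" "z t \<omega> - ys t"] by (simp add: abs_le_square_iff[symmetric] abs_mult)
    also have "\<dots> = (norm (noise t \<omega>))\<^sup>2 * (norm (z t \<omega> - ys t))\<^sup>2" by (rule power_mult_distrib)
    also have "\<dots> \<le> (2 * sq_bound t \<omega> + 2 * m\<^sup>2) * (2 * rad)\<^sup>2"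
      using n dist_le_rad[OF z_in ys] sq_bound_nonneg by (intro mult_mono power_mono) auto
    finally have "4 * (\<rho> t)\<^sup>2 * (noise t \<omega> \<bullet> (z t \<omega> - ys t))\<^sup>2 \<le> 4 * (\<rho> t)\<^sup>2 * ((2 * sq_bound t \<omega> + 2 * m\<^sup>2) * (2 * rad)\<^sup>2)"
      by (intro mult_left_mono) auto
    then have "(md t \<omega>)\<^sup>2 \<le> 2 * ?c * ((\<rho> t)\<^sup>2 * sq_bound t \<omega>) + 2 * ?c * m\<^sup>2 * (\<rho> t)\<^sup>2"
      unfolding md_def power_mult_distrib by (simp add: algebra_simps)
    also have "\<dots> \<le> ?m * ((\<rho> t)\<^sup>2 * sq_bound t \<omega>) + ?m * (\<rho> t)\<^sup>2"
      using sq_bound_nonneg by (intro add_mono mult_right_mono) auto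
    finally show "(md t \<omega>)\<^sup>2 \<le> ?m * ((\<rho> t)\<^sup>2 * sq_bound t \<omega> + (\<rho> t)\<^sup>2)" by (simp add: distrib_left)
  qed
qed

lemma summable_sq_bound: "summable (\<lambda>t. \<integral>\<omega>. (\<rho> t)\<^sup>2 * sq_bound t \<omega> \<partial>M)"
proof (rule summable_comparison_test')
  show "summable (\<lambda>t. ((\<rho> t)\<^sup>2 * kb t) * (2 * rad\<^sup>2 * c1 + 2 * c2))"
    by (rule summable_mult2[OF \<rho>2kb])
  fix t
  have "0 \<le> (\<integral>\<omega>. sq_bound t \<omega> \<partial>M)" using sq_bound_nonneg by simp
  then show "norm (\<integral>\<omega>. (\<rho> t)\<^sup>2 * sq_bound t \<omega> \<partial>M) \<le> ((\<rho> t)\<^sup>2 * kb t) * (2 * rad\<^sup>2 * c1 + 2 * c2)"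
    using mult_left_mono[OF sq_bound_mean[of t], of "(\<rho> t)\<^sup>2"] by (simp add: mult_ac)
qed

lemma md_square_integrable: "integrable M (\<lambda>\<omega>. (md t \<omega>)\<^sup>2)"
proof -
  obtain m where m: "0 \<le> m" "\<And>t \<omega>. (md t \<omega>)\<^sup>2 \<le> m * ((\<rho> t)\<^sup>2 * sq_bound t \<omega> + (\<rho> t)\<^sup>2)" using md_square by metis
  have [measurable]: "md t \<in> borel_measurable M" by (rule past_measurable_M[OF md_measurable])
  show ?thesis
  proof (rule Bochner_Integration.integrable_bound)
    show "integrable M (\<lambda>\<omega>. m * ((\<rho> t)\<^sup>2 * sq_bound t \<omega> + (\<rho> t)\<^sup>2))" using sq_bound_integrable by auto
    show "AE \<omega> in M. norm ((md t \<omega>)\<^sup>2) \<le> norm (m * ((\<rho> t)\<^sup>2 * sq_bound t \<omega> + (\<rho> t)\<^sup>2))"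
      using m by (auto intro!: order_trans[OF m(2)] AE_I2)
  qed simp
qed

lemma summable_md_square: "summable (\<lambda>t. \<integral>\<omega>. (md t \<omega>)\<^sup>2 \<partial>M)"
proof -
  obtain m where m: "0 \<le> m" "\<And>t \<omega>. (md t \<omega>)\<^sup>2 \<le> m * ((\<rho> t)\<^sup>2 * sq_bound t \<omega> + (\<rho> t)\<^sup>2)" using md_square by metis
  show ?thesis
  proof (rule summable_comparison_test')
    show "summable (\<lambda>t. m * ((\<integral>\<omega>. (\<rho> t)\<^sup>2 * sq_bound t \<omega> \<partial>M) + (\<rho> t)\<^sup>2))"
      by (intro summable_mult summable_add summable_sq_bound \<rho>2)
    fix t
    have "(\<integral>\<omega>. (md t \<omega>)\<^sup>2 \<partial>M) \<le> (\<integral>\<omega>. m * ((\<rho> t)\<^sup>2 * sq_bound t \<omega> + (\<rho> t)\<^sup>2) \<partial>M)"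
      using sq_bound_integrable m by (intro integral_mono md_square_integrable) auto
    also have "\<dots> = m * ((\<integral>\<omega>. (\<rho> t)\<^sup>2 * sq_bound t \<omega> \<partial>M) + (\<rho> t)\<^sup>2)"
      using sq_bound_integrable[of t] by (simp add: prob_space)
    finally show "norm (\<integral>\<omega>. (md t \<omega>)\<^sup>2 \<partial>M) \<le> m * ((\<integral>\<omega>. (\<rho> t)\<^sup>2 * sq_bound t \<omega> \<partial>M) + (\<rho> t)\<^sup>2)" by simp
  qed
qed

section \<open>Orthogonality of the noise to the past, and the Lyapunov inequality\<close>

lemma centred_obs_orthogonal:
  fixes f h :: "'w \<Rightarrow> real" and q :: "'a \<times> 'b \<Rightarrow> real"
  assumes i: "i \<in> {1..N t}" and f: "f \<in> borel_measurable (past t)" "integrable M f"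
    and h: "h \<in> borel_measurable (past t)" "\<And>\<omega>. \<bar>h \<omega>\<bar> \<le> c"
    and q[measurable]: "q \<in> borel_measurable borel" and qi: "integrable M (\<lambda>\<omega>. q (obs (t, i) \<omega>))"
    and q0: "(\<integral>\<omega>. q (obs (t, i) \<omega>) \<partial>M) = 0"
  shows "integrable M (\<lambda>\<omega>. q (obs (t, i) \<omega>) * h \<omega> * f \<omega>)"
    and "(\<integral>\<omega>. q (obs (t, i) \<omega>) * h \<omega> * f \<omega> \<partial>M) = 0"
proof -
  have hf: "(\<lambda>\<omega>. h \<omega> * f \<omega>) \<in> borel_measurable (past t)" using f h by measurable
  have hfi: "integrable M (\<lambda>\<omega>. h \<omega> * f \<omega>)"
  proof (rule Bochner_Integration.integrable_bound)
    show "integrable M (\<lambda>\<omega>. c * f \<omega>)" using f by simp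
    show "AE \<omega> in M. norm (h \<omega> * f \<omega>) \<le> norm (c * f \<omega>)"
      using h(2) by (auto simp: abs_mult intro!: mult_right_mono AE_I2 order_trans[OF h(2)])
  qed (rule past_measurable_M[OF hf])
  from expectation_past_times_obs[OF i hf hfi q qi] q0
  show "integrable M (\<lambda>\<omega>. q (obs (t, i) \<omega>) * h \<omega> * f \<omega>)"
    and "(\<integral>\<omega>. q (obs (t, i) \<omega>) * h \<omega> * f \<omega> \<partial>M) = 0"
    by (simp_all add: mult_ac)
qed

text \<open>The inner product mixes the iterate with the current batch. It is expanded into scalar
  products of a centred function of one observation and a bounded function of the past:
  \<open>q\<close> with \<open>h\<close> for the kernel weight, and coordinatewise \<open>qj\<close>
  with \<open>hj\<close> for the weighted response.\<close>

lemma md_orthogonal: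
  assumes f: "f \<in> borel_measurable (past t)" "integrable M (\<lambda>\<omega>. (f \<omega>)\<^sup>2)"
  shows "(\<integral>\<omega>. md t \<omega> * f \<omega> \<partial>M) = 0"
proof -
  have fi: "integrable M f"
    by (rule square_integrable_imp_integrable[OF past_measurable_M[OF f(1)] f(2)])
  note [measurable] = z_measurable[of t]
  define h where "h = (\<lambda>\<omega>. z t \<omega> \<bullet> (z t \<omega> - ys t))"
  define hj where "hj = (\<lambda>j \<omega>. (z t \<omega> - ys t) \<bullet> j)"
  define q where "q = (\<lambda>p::'a \<times> 'b. k t (fst p) - a t)"
  define qj where "qj = (\<lambda>j p. (k t (fst p) *\<^sub>R snd p - b t) \<bullet> j)"
  have [measurable]: "(fst :: 'a \<times> 'b \<Rightarrow> 'a) \<in> borel_measurable borel" "(snd :: 'a \<times> 'b \<Rightarrow> 'b) \<in> borel_measurable borel"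
    by (auto intro!: borel_measurable_continuous_onI continuous_intros)
  have h: "h \<in> borel_measurable (past t)" and hj: "hj j \<in> borel_measurable (past t)" for j
    unfolding h_def hj_def by measurable
  have h_bd: "\<bar>h \<omega>\<bar> \<le> rad * (2 * rad)" for \<omega>
  proof -
    have "\<bar>h \<omega>\<bar> \<le> norm (z t \<omega>) * norm (z t \<omega> - ys t)" unfolding h_def by (rule Cauchy_Schwarz_ineq2)
    also have "\<dots> \<le> rad * (2 * rad)"
      using norm_le_rad[OF z_in] dist_le_rad[OF z_in ys] rad0 by (intro mult_mono) auto
    finally show ?thesis .
  qed
  have hj_bd: "\<bar>hj j \<omega>\<bar> \<le> 2 * rad" if "j \<in> Basis" for j \<omega>
    using Basis_le_norm[OF that, of "z t \<omega> - ys t"] dist_le_rad[OF z_in ys, of t \<omega> t] by (simp add: hj_def)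
  have q: "q \<in> borel_measurable borel" and qj: "qj j \<in> borel_measurable borel" for j
    unfolding q_def qj_def by measurable
  have qi: "integrable M (\<lambda>\<omega>. q (obs (t, i) \<omega>))" "(\<integral>\<omega>. q (obs (t, i) \<omega>) \<partial>M) = 0" if "i \<in> {1..N t}" for i
    using k_int[OF that] k_mean[OF that] by (auto simp: q_def obs_def prob_space)
  have qji: "integrable M (\<lambda>\<omega>. qj j (obs (t, i) \<omega>))" "(\<integral>\<omega>. qj j (obs (t, i) \<omega>) \<partial>M) = 0" if "i \<in> {1..N t}" for i j
    using ky_int[OF that] ky_mean[OF that] by (auto simp: qj_def obs_def prob_space)
  have "noise t \<omega> = (1 / real (N t)) *\<^sub>R (\<Sum>i=1..N t. q (obs (t, i) \<omega>) *\<^sub>R z t \<omega> - (k t (xo t i \<omega>) *\<^sub>R yo t i \<omega> - b t))" for \<omega>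
  proof -
    have "(\<Sum>i=1..N t. q (obs (t, i) \<omega>) *\<^sub>R z t \<omega> - (k t (xo t i \<omega>) *\<^sub>R yo t i \<omega> - b t)) =
        (\<Sum>i=1..N t. k t (xo t i \<omega>) *\<^sub>R (z t \<omega> - yo t i \<omega>) - (a t *\<^sub>R z t \<omega> - b t))"
      by (intro sum.cong) (auto simp: q_def obs_def algebra_simps)
    also have "\<dots> = (\<Sum>i=1..N t. k t (xo t i \<omega>) *\<^sub>R (z t \<omega> - yo t i \<omega>)) - real (N t) *\<^sub>R (a t *\<^sub>R z t \<omega> - b t)"
      by (subst sum_subtractf) (simp add: sum_constant_scaleR)
    finally show ?thesis
      using N[of t] by (simp add: noise_def direction_def scaleR_diff_right[of "1 / real (N t)"])
  qed
  moreover have "(k t (xo t i \<omega>) *\<^sub>R yo t i \<omega> - b t) \<bullet> (z t \<omega> - ys t) = (\<Sum>j\<in>Basis. qj j (obs (t, i) \<omega>) * hj j \<omega>)" for i \<omega>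
    unfolding qj_def hj_def obs_def prod.case fst_conv snd_conv by (rule euclidean_inner)
  ultimately have "noise t \<omega> \<bullet> (z t \<omega> - ys t) =
      (1 / real (N t)) * (\<Sum>i=1..N t. q (obs (t, i) \<omega>) * h \<omega> - (\<Sum>j\<in>Basis. qj j (obs (t, i) \<omega>) * hj j \<omega>))" for \<omega>
    by (simp only: inner_scaleR_left inner_sum_left inner_diff_left[of "_ *\<^sub>R z t \<omega>"] h_def)
  then have eq: "md t \<omega> * f \<omega> = (- 2 * \<rho> t / real (N t)) * (\<Sum>i=1..N t. q (obs (t, i) \<omega>) * h \<omega> * f \<omega> -
      (\<Sum>j\<in>Basis. qj j (obs (t, i) \<omega>) * hj j \<omega> * f \<omega>))" for \<omega>
    by (simp add: md_def sum_distrib_right left_diff_distrib mult.assoc mult.commute[of "f \<omega>"])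
  note o = centred_obs_orthogonal[OF _ f(1) fi h h_bd q qi]
  note oj = centred_obs_orthogonal[OF _ f(1) fi hj hj_bd qj qji]
  show ?thesis
    unfolding eq using o oj by (simp add: Bochner_Integration.integral_sum)
qed

sublocale md: martingale_differences M past md
  by unfold_locales
    (use sets_past_subset sets_past_mono md_measurable md_square_integrable md_orthogonal in auto)

text \<open>One step towards the old target is estimated first, then the target is moved. The cost
  of moving is written as \<open>\<rho> t\<close> times \<open>\<delta> t / \<rho> t\<close>, so
  that it joins the bias as a perturbation that is small relative to the step.\<close>

lemma lyapunov_step:
  assumes w: "\<kappa> \<le> w t"
  shows "(norm (z (Suc t) \<omega> - ys (Suc t)))\<^sup>2 \<le> (1 - (2 * \<kappa>) * \<rho> t) * (norm (z t \<omega> - ys t))\<^sup>2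
     + \<rho> t * (4 * rad * \<epsilon> t + 6 * rad * (\<delta> t / \<rho> t)) + (\<rho> t)\<^sup>2 * sq_bound t \<omega> + md t \<omega>"
proof -
  have cl: "closed C" "C \<noteq> {}" using C z0 by (auto simp: compact_imp_closed)
  let ?e = "z t \<omega> - ys t" and ?A = "z (Suc t) \<omega> - ys t" and ?B = "ys t - ys (Suc t)"
  let ?r = "a t *\<^sub>R z t \<omega> - b t - w t *\<^sub>R ?e"
  have zS: "z (Suc t) \<omega> = closest_point C (z t \<omega> - \<rho> t *\<^sub>R direction t \<omega>)"
    by (simp add: z_Suc direction_def)
  \<comment> \<open>The target lies in \<open>C\<close> and is its own projection, so
    nonexpansiveness compares the new iterate directly with it.\<close>
  have "norm ?A \<le> norm (?e - \<rho> t *\<^sub>R direction t \<omega>)"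
    using closest_point_lipschitz[OF C(1) cl, of "z t \<omega> - \<rho> t *\<^sub>R direction t \<omega>" "ys t"]
    by (simp add: zS closest_point_self ys dist_norm algebra_simps)
  then have "(norm ?A)\<^sup>2 \<le> (norm (?e - \<rho> t *\<^sub>R direction t \<omega>))\<^sup>2" by (rule power_mono) simp
  also have "\<dots> = (norm ?e)\<^sup>2 - 2 * \<rho> t * (direction t \<omega> \<bullet> ?e) + (\<rho> t)\<^sup>2 * (norm (direction t \<omega>))\<^sup>2"
    unfolding power2_norm_eq_inner by (simp add: inner_diff_left inner_diff_right inner_commute power2_eq_square algebra_simps)
  also have "\<dots> \<le> (norm ?e)\<^sup>2 - 2 * \<rho> t * (direction t \<omega> \<bullet> ?e) + (\<rho> t)\<^sup>2 * sq_bound t \<omega>"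
    using direction_square_le by (intro add_left_mono mult_left_mono) auto
  \<comment> \<open>Martingale noise, contraction towards the target, and the smoothing
    bias.\<close>
  also have "direction t \<omega> = noise t \<omega> + w t *\<^sub>R ?e + ?r" by (simp add: noise_def)
  also have "(noise t \<omega> + w t *\<^sub>R ?e + ?r) \<bullet> ?e = noise t \<omega> \<bullet> ?e + w t * (norm ?e)\<^sup>2 + ?r \<bullet> ?e"
    unfolding power2_norm_eq_inner inner_add_left inner_scaleR_left ..
  finally have 1: "(norm ?A)\<^sup>2 \<le> (norm ?e)\<^sup>2 - 2 * \<rho> t * (noise t \<omega> \<bullet> ?e + w t * (norm ?e)\<^sup>2 + ?r \<bullet> ?e) + (\<rho> t)\<^sup>2 * sq_bound t \<omega>" .
  have "\<bar>?r \<bullet> ?e\<bar> \<le> norm ?r * norm ?e" by (rule Cauchy_Schwarz_ineq2)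
  also have "\<dots> \<le> \<epsilon> t * (2 * rad)"
    using bias[OF z_in] dist_le_rad[OF z_in ys] order_trans[OF norm_ge_zero bias[OF z_in, of t undefined]]
    by (intro mult_mono) auto
  finally have "- (2 * rad * \<epsilon> t) \<le> ?r \<bullet> ?e" by (simp add: mult_ac abs_le_iff)
  moreover have "\<kappa> * (norm ?e)\<^sup>2 \<le> w t * (norm ?e)\<^sup>2" using w by (intro mult_right_mono) auto
  ultimately have "\<rho> t * (\<kappa> * (norm ?e)\<^sup>2 - 2 * rad * \<epsilon> t) \<le> \<rho> t * (w t * (norm ?e)\<^sup>2 + ?r \<bullet> ?e)"
    using \<rho>[of t] by (intro mult_left_mono) auto
  with 1 have 2: "(norm ?A)\<^sup>2 \<le> (1 - (2 * \<kappa>) * \<rho> t) * (norm ?e)\<^sup>2 + \<rho> t * (4 * rad * \<epsilon> t) + (\<rho> t)\<^sup>2 * sq_bound t \<omega> + md t \<omega>"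
    by (simp add: md_def algebra_simps)
  have B: "norm ?B \<le> \<delta> t" using \<delta>[of t] by (simp add: norm_minus_commute)
  have "(norm (z (Suc t) \<omega> - ys (Suc t)))\<^sup>2 = (norm (?A + ?B))\<^sup>2" by simp
  also have "\<dots> = (norm ?A)\<^sup>2 + 2 * (?A \<bullet> ?B) + norm ?B * norm ?B"
    unfolding power2_norm_eq_inner by (simp only: inner_add_left inner_add_right inner_commute norm_eq_sqrt_inner real_sqrt_mult_self abs_of_nonneg[OF inner_ge_zero])
  also have "?A \<bullet> ?B \<le> norm ?A * norm ?B" by (rule norm_cauchy_schwarz)
  also have "norm ?A * norm ?B \<le> 2 * rad * \<delta> t"
    using dist_le_rad[OF z_in ys] B rad0 by (intro mult_mono) auto
  \<comment> \<open>One factor is bounded by the diameter, making the quadratic term linear in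
    \<open>\<delta> t\<close>. With twice the cross term this gives 4 + 2 = 6.\<close>
  also have "norm ?B * norm ?B \<le> 2 * rad * \<delta> t"
    using dist_le_rad[OF ys ys] B rad0 by (intro mult_mono) auto
  finally have "(norm (z (Suc t) \<omega> - ys (Suc t)))\<^sup>2 \<le> (norm ?A)\<^sup>2 + 6 * rad * \<delta> t" by simp
  with 2 show ?thesis using \<rho>[of t] by (simp add: algebra_simps)
qed

theorem tracking: "AE \<omega> in M. (\<lambda>t. z t \<omega> - ys t) \<longlonglongrightarrow> 0"
proof -
  have "AE \<omega> in M. summable (\<lambda>t. (\<rho> t)\<^sup>2 * sq_bound t \<omega>)"
    using sq_bound_integrable sq_bound_nonneg summable_sq_bound
    by (intro AE_summable_of_summable_integrals) auto
  with md.sums_converge_AE[OF summable_md_square] show ?thesis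
  proof eventually_elim
    case (elim \<omega>)
    have "(\<lambda>t. 4 * rad * \<epsilon> t + 6 * rad * (\<delta> t / \<rho> t)) \<longlonglongrightarrow> 4 * rad * 0 + 6 * rad * 0"
      by (intro tendsto_intros \<epsilon> \<delta>\<rho>)
    then have \<eta>: "(\<lambda>t. 4 * rad * \<epsilon> t + 6 * rad * (\<delta> t / \<rho> t)) \<longlonglongrightarrow> 0" by simp
    have "(\<lambda>t. (norm (z t \<omega> - ys t))\<^sup>2) \<longlonglongrightarrow> 0"
    proof (rule stochastic_approximation_recursion[where S = "\<lambda>n. \<Sum>t<n. md t \<omega>" and \<kappa> = "2 * \<kappa>"])
      show "\<forall>\<^sub>F t in sequentially. (norm (z (Suc t) \<omega> - ys (Suc t)))\<^sup>2 \<le> (1 - 2 * \<kappa> * \<rho> t) * (norm (z t \<omega> - ys t))\<^sup>2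
         + \<rho> t * (4 * rad * \<epsilon> t + 6 * rad * (\<delta> t / \<rho> t)) + (\<rho> t)\<^sup>2 * sq_bound t \<omega> + ((\<Sum>t<Suc t. md t \<omega>) - (\<Sum>t<t. md t \<omega>))"
        using w by eventually_elim (use lyapunov_step in simp)
    qed (use \<kappa> \<rho> \<rho>0 \<rho>_div \<eta> elim in auto)
    then have "(\<lambda>t. sqrt ((norm (z t \<omega> - ys t))\<^sup>2)) \<longlonglongrightarrow> sqrt 0" by (rule tendsto_real_sqrt)
    then show ?case by (simp add: tendsto_norm_zero_iff)
  qed
qed

end

section \<open>Regression estimates\<close>

text \<open>It allows the means of a batch to be defined through its first observation.\<close>

lemma sampled_from_expectation_eq:
  fixes h :: "(real^'r) \<times> (real^'m) \<Rightarrow> 'b::{banach, second_countable_topology}"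
  assumes "sampled_from M X Y g xo yo" "sampled_from M X Y g xo' yo'"
    and h[measurable]: "h \<in> borel_measurable borel"
  shows "(\<integral>\<omega>. h (xo \<omega>, yo \<omega>) \<partial>M) = (\<integral>\<omega>. h (xo' \<omega>, yo' \<omega>) \<partial>M)"
proof -
  note d = assms(1,2)[unfolded sampled_from_def]
  note rv = d[THEN distributed_measurable]
  have "(\<integral>\<omega>. h (xo \<omega>, yo \<omega>) \<partial>M) = (\<integral>p. h p \<partial>distr M lborel (\<lambda>\<omega>. (xo \<omega>, yo \<omega>)))"
    by (subst integral_distr[OF rv(1)]) auto
  also have "\<dots> = (\<integral>p. h p \<partial>distr M lborel (\<lambda>\<omega>. (xo' \<omega>, yo' \<omega>)))"
    using d[THEN distributed_distr_eq_density] by simp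
  also have "\<dots> = (\<integral>\<omega>. h (xo' \<omega>, yo' \<omega>) \<partial>M)"
    by (subst integral_distr[OF rv(2)]) auto
  finally show ?thesis .
qed

text \<open>First moments are interpolated between the zeroth and second ones through |v| <= 1 +
  |v|^2; this is applied both to the Hoelder constant and to the section of the density at
  x.\<close>

lemma set_integrable_norm_mult:
  fixes f :: "'a::euclidean_space \<Rightarrow> real"
  assumes f: "set_integrable lborel Y f" and f2: "set_integrable lborel Y (\<lambda>v. (norm v)\<^sup>2 * f v)"
  shows "set_integrable lborel Y (\<lambda>v. norm v * f v)"
  unfolding set_integrable_def
proof (rule Bochner_Integration.integrable_bound)
  let ?b = "\<lambda>v. \<bar>indicator Y v *\<^sub>R f v\<bar> + \<bar>indicator Y v *\<^sub>R ((norm v)\<^sup>2 * f v)\<bar>"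
  show "integrable lborel ?b"
    using f f2 unfolding set_integrable_def by (intro Bochner_Integration.integrable_add integrable_abs)
  have [measurable]: "(\<lambda>v. indicator Y v *\<^sub>R f v) \<in> borel_measurable borel"
    using f borel_measurable_integrable unfolding set_integrable_def by auto
  have "(\<lambda>v. norm v * (indicator Y v *\<^sub>R f v)) \<in> borel_measurable borel" by measurable
  then show "(\<lambda>v. indicator Y v *\<^sub>R (norm v * f v)) \<in> borel_measurable lborel"
    by (simp add: mult_ac)
  have "norm v * \<bar>f v\<bar> \<le> \<bar>f v\<bar> + (norm v)\<^sup>2 * \<bar>f v\<bar>" for v
  proof -
    have "norm v \<le> 1 + (norm v)\<^sup>2"
      using sum_squares_bound[of 1 "norm v"] norm_ge_zero[of v] unfolding mult_1_right power_one by linarith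
    from mult_right_mono[OF this abs_ge_zero[of "f v"]] show ?thesis by (simp add: algebra_simps)
  qed
  then show "AE v in lborel. norm (indicator Y v *\<^sub>R (norm v * f v)) \<le> norm (?b v)"
    by (auto simp: abs_mult indicator_def)
qed

text \<open>The normalisation of the kernel concerns \<open>X\<close> only, whereas rescaled windows
  reach beyond it. Integrability on the whole space comes from boundedness on the unit ball and from
  the moment outside it.\<close>

lemma integrable_of_bounded_of_moment:
  fixes K :: "'a::euclidean_space \<Rightarrow> real"
  assumes [measurable]: "K \<in> borel_measurable borel" and K0: "\<And>u. 0 \<le> K u" and Kb: "\<And>u. K u \<le> c"
    and \<nu>: "0 \<le> \<nu>" and mom: "integrable lborel (\<lambda>u. norm u powr \<nu> * K u)"
  shows "integrable lborel K"
proof (rule Bochner_Integration.integrable_bound)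
  let ?b = "\<lambda>u. c * indicator (cball 0 1) u + norm u powr \<nu> * K u"
  have "integrable lborel (indicator (cball (0::'a) 1) :: 'a \<Rightarrow> real)"
    by (rule integrable_real_indicator[OF _ emeasure_lborel_cball_finite]) simp
  then show "integrable lborel ?b" using mom by simp
  have "K u \<le> ?b u" for u
  proof (cases "norm u \<le> 1")
    case True
    then show ?thesis using Kb[of u] K0[of u] by (simp add: add_increasing2)
  next
    case False
    then have "1 \<le> norm u powr \<nu>" using \<nu> by (simp add: ge_one_powr_ge_zero)
    from mult_right_mono[OF this K0[of u]] False show ?thesis by simp
  qed
  then show "AE u in lborel. norm (K u) \<le> norm (?b u)"
    using K0 by (auto intro!: AE_I2 order_trans[OF _ abs_ge_self])
qed simp

locale sqg_regression = prob_space M for M :: "'w measure" +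
  fixes X :: "(real^'r) set" and Y :: "(real^'m) set"
    and g :: "nat \<Rightarrow> real^'r \<Rightarrow> real^'m \<Rightarrow> real" and C :: "(real^'m) set"
    and K :: "real^'r \<Rightarrow> real" and L :: "real^'m \<Rightarrow> real" and N :: "nat \<Rightarrow> nat"
    and xo :: "nat \<Rightarrow> nat \<Rightarrow> 'w \<Rightarrow> real^'r" and yo :: "nat \<Rightarrow> nat \<Rightarrow> 'w \<Rightarrow> real^'m"
    and \<rho> \<theta> \<delta> :: "nat \<Rightarrow> real" and \<nu> g1 g1bar g3bar :: real
    and x :: "real^'r" and z0 :: "real^'m"
  assumes X: "X \<in> sets borel" and Y: "Y \<in> sets borel" and dens: "\<And>t. density_on X Y (g t)"
    and N: "\<And>t. 1 \<le> N t"
    and samp: "\<And>t i. i \<in> {1..N t} \<Longrightarrow> sampled_from M X Y (g t) (xo t i) (yo t i)"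
    and indep: "indep_vars (\<lambda>_. borel) (\<lambda>(t, i) \<omega>. (xo t i \<omega>, yo t i \<omega>)) (SIGMA t:UNIV. {1..N t})"
    and x: "x \<in> X" and C: "convex C" "compact C" and z0: "z0 \<in> C"
    and regr_in: "\<And>t. regression Y (g t) x \<in> C"
    and \<delta>: "\<And>t. norm (regression Y (g (Suc t)) x - regression Y (g t) x) \<le> \<delta> t"
    and \<nu>: "\<nu> > 0" and hoelder: "globally_hoelder X Y \<nu> L g"
    and L: "set_integrable lborel Y L" and L2: "set_integrable lborel Y (\<lambda>v. (norm v)\<^sup>2 * L v)"
    and marg_ge: "\<And>t. g1 \<le> marginal1 Y (g t) x" and marg_le: "\<And>t. marginal1 Y (g t) x \<le> g1bar"
    and marg2: "\<And>t. set_integrable lborel Y (\<lambda>v. (norm v)\<^sup>2 * marginal2 X (g t) v)"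
    and marg2_le: "\<And>t. (LINT v:Y|lborel. (norm v)\<^sup>2 * marginal2 X (g t) v) \<le> g3bar"
    and K_meas: "K \<in> borel_measurable borel" and K0: "\<And>u. 0 \<le> K u" and K_bdd: "bounded (range K)"
    and K\<nu>: "integrable lborel (\<lambda>u. norm u powr \<nu> * K u)"
    and window: "window_retained X K x \<theta>"
    and \<rho>: "\<And>t. \<rho> t > 0" and \<theta>: "\<And>t. \<theta> t > 0" and \<delta>\<rho>: "(\<lambda>t. \<delta> t / \<rho> t) \<longlonglongrightarrow> 0"
    and \<rho>0: "\<rho> \<longlonglongrightarrow> 0" and \<theta>0: "\<theta> \<longlonglongrightarrow> 0"
    and \<rho>_div: "filterlim (\<lambda>n. \<Sum>t<n. \<rho> t) at_top sequentially"
    and \<rho>2: "summable (\<lambda>t. (\<rho> t)\<^sup>2 / \<theta> t ^ CARD('r))"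
    and g1: "g1 > 0"
begin

text \<open>The smoothing lemmas require a constant that is nonnegative everywhere, while the
  Hoelder condition constrains \<open>L\<close> only almost everywhere on \<open>Y\<close>.\<close>

abbreviation "\<Lambda> \<equiv> \<lambda>v. \<bar>L v\<bar>"
abbreviation "k t \<equiv> scaled_kernel K x (\<theta> t)"
abbreviation "marg t \<equiv> marginal1 Y (g t) x"
abbreviation "regr t \<equiv> regression Y (g t) x"
definition "mass t = (LINT u:X|lborel. k t u)"
definition "spread = (\<integral>u. norm u powr \<nu> * K u \<partial>lborel)"

lemma hoelder_at: "AE v in lborel. v \<in> Y \<longrightarrow> (\<forall>u\<in>X. \<bar>g t u v - g t x v\<bar> \<le> \<Lambda> v * norm (u - x) powr \<nu>)"
  using hoelder unfolding globally_hoelder_def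
proof eventually_elim
  case (elim v)
  have "L v * norm (u - x) powr \<nu> \<le> \<Lambda> v * norm (u - x) powr \<nu>" for u
    by (intro mult_right_mono) auto
  with elim x show ?case by (meson order_trans)
qed

lemma K_integrable: "integrable lborel K"
proof -
  obtain c where "\<And>u. norm (K u) \<le> c" using K_bdd by (auto simp: bounded_iff)
  then show ?thesis
    using K_meas K0 \<nu> K\<nu> by (intro integrable_of_bounded_of_moment[of K c \<nu>]) (auto intro: order_trans[OF abs_ge_self])
qed

lemmas kernel_facts = scaled_kernel_integrals[OF \<theta> K_integrable K\<nu> X]

lemma k_nonneg: "0 \<le> k t u"
  using K0 \<theta>[of t] by (simp add: scaled_kernel_def)

lemma k_measurable: "k t \<in> borel_measurable borel"
  using borel_measurable_integrable[OF kernel_facts(1)] by simp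

lemma spread_nonneg: "0 \<le> spread"
  unfolding spread_def using K0 by simp

lemma mass_bounds: "0 \<le> mass t" "mass t \<le> (\<integral>u. K u \<partial>lborel)"
proof -
  have "(\<integral>u. k t u \<partial>lborel) = (\<integral>u. K u \<partial>lborel)"
    unfolding scaled_kernel_def by (rule lborel_rescale(2)[OF \<theta> K_integrable])
  moreover have "mass t \<le> (\<integral>u. k t u \<partial>lborel)"
    unfolding mass_def set_lebesgue_integral_def
    using kernel_facts(1) integrable_mult_indicator[of X lborel "k t"] X k_nonneg
    by (intro integral_mono) (auto simp: indicator_def)
  ultimately show "mass t \<le> (\<integral>u. K u \<partial>lborel)" by simp
  show "0 \<le> mass t"
    unfolding mass_def set_lebesgue_integral_def using k_nonneg by (intro Bochner_Integration.integral_nonneg) auto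
qed

lemma mass_eventually: obtains c where "0 < c" "\<forall>\<^sub>F t in sequentially. c \<le> mass t"
  using window unfolding window_retained_def kernel_facts(4)[symmetric] mass_def[symmetric] by blast

lemma smoothing:
  fixes \<phi> :: "real^'m \<Rightarrow> 'b::{banach, second_countable_topology}"
  assumes i: "i \<in> {1..N t}" and \<phi>: "\<phi> \<in> borel_measurable borel"
    and \<phi>\<Lambda>: "set_integrable lborel Y (\<lambda>v. norm (\<phi> v) * \<Lambda> v)"
    and \<phi>g: "set_integrable lborel Y (\<lambda>v. g t x v *\<^sub>R \<phi> v)"
  shows "integrable M (\<lambda>\<omega>. k t (xo t i \<omega>) *\<^sub>R \<phi> (yo t i \<omega>))"
    and "norm ((\<integral>\<omega>. k t (xo t i \<omega>) *\<^sub>R \<phi> (yo t i \<omega>) \<partial>M) - mass t *\<^sub>R (LINT v:Y|lborel. g t x v *\<^sub>R \<phi> v))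
           \<le> \<theta> t powr \<nu> * (spread * (LINT v:Y|lborel. norm (\<phi> v) * \<Lambda> v))"
  using kernel_smoothing[OF X Y dens samp[OF i] x hoelder_at _ \<phi> \<phi>\<Lambda> \<phi>g k_nonneg kernel_facts(1) kernel_facts(2)]
  by (simp_all add: mass_def kernel_facts(3) spread_def mult.assoc)

lemma L_abs: "set_integrable lborel Y \<Lambda>"
  using integrable_abs[OF L[unfolded set_integrable_def]] by (simp add: set_integrable_def abs_mult)

lemma L2_abs: "set_integrable lborel Y (\<lambda>v. (norm v)\<^sup>2 * \<Lambda> v)"
  using integrable_abs[OF L2[unfolded set_integrable_def]] by (simp add: set_integrable_def abs_mult)

lemma L1_abs: "set_integrable lborel Y (\<lambda>v. norm v * \<Lambda> v)"
  by (rule set_integrable_norm_mult[OF L_abs L2_abs])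

text \<open>A non-integrable section would have marginal 0 by the convention for the integral,
  contradicting the positive lower bound.\<close>

lemma g_integrable: "set_integrable lborel Y (g t x)"
proof (rule ccontr)
  assume "\<not> ?thesis"
  then have "marg t = 0"
    by (simp add: marginal1_def set_lebesgue_integral_def set_integrable_def not_integrable_integral_eq)
  then show False using marg_ge[of t] g1 by simp
qed

text \<open>The averaging set for \<open>section_moment_bound\<close> is \<open>X\<close> cut by a
  large ball around x. It is the same for all t, which makes the bound uniform.\<close>

lemma section_second_moment:
  obtains G where "\<And>t. set_integrable lborel Y (\<lambda>v. (norm v)\<^sup>2 * g t x v)"
    and "\<And>t. (LINT v:Y|lborel. (norm v)\<^sup>2 * g t x v) \<le> G"
proof -
  obtain c where c: "0 < c" "\<forall>\<^sub>F t in sequentially. c \<le> mass t" by (rule mass_eventually)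
  then obtain t where t: "c \<le> mass t" using eventually_happens by force
  \<comment> \<open>A null \<open>X\<close> would annihilate every kernel mass, against the retained
    window; some ball around x therefore meets \<open>X\<close> in positive measure.\<close>
  have "emeasure lborel X \<noteq> 0"
  proof
    assume "emeasure lborel X = 0"
    then have "AE u in lborel. u \<notin> X" using X by (intro AE_not_in null_setsI) auto
    then have "mass t = 0" unfolding mass_def set_lebesgue_integral_def
      by (intro integral_eq_zero_AE) (auto elim!: eventually_mono)
    with c t show False by simp
  qed
  moreover have XU: "(\<Union>n::nat. X \<inter> cball x (real n)) = X"
    using real_arch_simple by (auto simp: dist_norm)
  ultimately have "\<exists>n::nat. emeasure lborel (X \<inter> cball x (real n)) \<noteq> 0"
    using emeasure_UN_eq_0[of lborel "\<lambda>n::nat. X \<inter> cball x (real n)", unfolded XU] X by (auto simp: image_subset_iff)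
  then obtain n :: nat where n: "emeasure lborel (X \<inter> cball x (real n)) \<noteq> 0" ..
  let ?B = "X \<inter> cball x (real n)"
  have "emeasure lborel ?B \<le> emeasure lborel (cball x (real n))" using X by (intro emeasure_mono) auto
  also have "\<dots> < \<infinity>" by (rule emeasure_lborel_cball_finite)
  finally have fin: "emeasure lborel ?B < \<infinity>" .
  then have pos: "0 < measure lborel ?B" using n by (simp add: measure_def enn2real_positive_iff zero_less_iff_neq_zero)
  have m: "(\<lambda>v::real^'m. (norm v)\<^sup>2) \<in> borel_measurable borel" by measurable
  have R: "norm (u - x) \<le> real n" if "u \<in> ?B" for u using that by (simp add: dist_norm norm_minus_commute)
  note bound = section_moment_bound[OF X Y dens x hoelder_at _ _ m _ marg2 L2_abs _ _ fin pos R]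
  show ?thesis
  proof (rule that)
    fix t
    show "set_integrable lborel Y (\<lambda>v. (norm v)\<^sup>2 * g t x v)" using bound(1)[of t] \<nu> X by simp
    have "(LINT v:Y|lborel. (norm v)\<^sup>2 * g t x v) \<le> (LINT v:Y|lborel. (norm v)\<^sup>2 * marginal2 X (g t) v) / measure lborel ?B
        + real n powr \<nu> * (LINT v:Y|lborel. (norm v)\<^sup>2 * \<Lambda> v)"
      using bound(2)[of t] \<nu> X by simp
    also have "\<dots> \<le> g3bar / measure lborel ?B + real n powr \<nu> * (LINT v:Y|lborel. (norm v)\<^sup>2 * \<Lambda> v)"
      using marg2_le pos by (intro add_right_mono divide_right_mono) auto
    finally show "(LINT v:Y|lborel. (norm v)\<^sup>2 * g t x v) \<le> g3bar / measure lborel ?B + real n powr \<nu> * (LINT v:Y|lborel. (norm v)\<^sup>2 * \<Lambda> v)" .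
  qed
qed

theorem consistent:
  "AE \<omega> in M. (\<lambda>t. sqg_estimate C K x \<rho> \<theta> N (\<lambda>s i. xo s i \<omega>) (\<lambda>s i. yo s i \<omega>) z0 t - regr t) \<longlonglongrightarrow> 0"
proof -
  obtain Kb where Kb: "\<And>u. K u \<le> Kb"
    using K_bdd by (auto simp: bounded_iff intro: order_trans[OF abs_ge_self])
  obtain r where r: "\<And>v. v \<in> C \<Longrightarrow> norm v \<le> r"
    using compact_imp_bounded[OF C(2)] by (auto simp: bounded_iff)
  obtain c where c: "0 < c" "\<forall>\<^sub>F t in sequentially. c \<le> mass t" by (rule mass_eventually)
  obtain T where T: "\<And>t. \<theta> t \<le> T"
    using convergent_imp_Bseq[of \<theta>] \<theta>0 by (auto simp: convergent_def Bseq_def intro: order_trans[OF abs_ge_self])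
  obtain G where G: "\<And>t. set_integrable lborel Y (\<lambda>v. (norm v)\<^sup>2 * g t x v)"
      "\<And>t. (LINT v:Y|lborel. (norm v)\<^sup>2 * g t x v) \<le> G"
    using section_second_moment by metis
  let ?KI = "\<integral>u. K u \<partial>lborel"
  let ?L0 = "LINT v:Y|lborel. \<Lambda> v" and ?L1 = "LINT v:Y|lborel. norm v * \<Lambda> v"
    and ?L2 = "LINT v:Y|lborel. (norm v)\<^sup>2 * \<Lambda> v"
  have L_nonneg: "0 \<le> ?L0" "0 \<le> ?L1" "0 \<le> ?L2"
    by (auto simp: set_lebesgue_integral_def)
  define a where "a = (\<lambda>t. \<integral>\<omega>. k t (xo t 1 \<omega>) \<partial>M)"
  define b where "b = (\<lambda>t. \<integral>\<omega>. k t (xo t 1 \<omega>) *\<^sub>R yo t 1 \<omega> \<partial>M)"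
  \<comment> \<open>The two summands are the smoothing errors of \<open>a\<close> and
    \<open>b\<close>; the first is multiplied by the norm of a point of \<open>C\<close>, hence by
    \<open>r\<close>.\<close>
  define \<epsilon> where "\<epsilon> = (\<lambda>t. \<theta> t powr \<nu> * (spread * (r * ?L0 + ?L1)))"
  have one: "1 \<in> {1..N t}" for t using N[of t] by simp
  have r0: "0 \<le> r" using r[OF z0] norm_ge_zero[of z0] by linarith
  have marg_pos: "0 < marg t" for t using marg_ge[of t] g1 by linarith
  have \<theta>T: "\<theta> t powr \<nu> \<le> T powr \<nu>" for t using T[of t] \<theta>[of t] \<nu> by (intro powr_mono2) auto
  have gv: "set_integrable lborel Y (\<lambda>v. g t x v *\<^sub>R v)" for t
  proof -
    have "(\<lambda>v. (indicator Y v * g t x v) *\<^sub>R v) \<in> borel_measurable borel"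
      using density_section_measurable[OF dens x, of t] by measurable
    then have "(\<lambda>v. indicator Y v *\<^sub>R (g t x v *\<^sub>R v)) \<in> borel_measurable lborel" by simp
    from Bochner_Integration.integrable_bound[OF set_integrable_norm_mult[OF g_integrable[of t] G(1)[of t], unfolded set_integrable_def] this]
    show ?thesis unfolding set_integrable_def by (simp add: abs_mult mult_ac)
  qed
  \<comment> \<open>The main term of \<open>b\<close> is thus the main term of \<open>a\<close>
    times the regression value, which makes the regression the zero of the limiting drift.\<close>
  have regr_eq: "(LINT v:Y|lborel. g t x v *\<^sub>R v) = marg t *\<^sub>R regr t" for t
    using marg_pos[of t] by (simp add: regression_def)
  note s0 = smoothing[where \<phi> = "\<lambda>_. 1::real", simplified real_scaleR_def mult_1_right norm_one mult_1_left, OF _ _ L_abs g_integrable]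
  note s1 = smoothing[where \<phi> = "\<lambda>v. v", OF _ _ L1_abs gv]
  have gv2: "set_integrable lborel Y (\<lambda>v. g t x v *\<^sub>R (norm v)\<^sup>2)" for t
    using G(1)[of t] by (simp add: mult.commute)
  have L2': "set_integrable lborel Y (\<lambda>v. norm ((norm v)\<^sup>2) * \<Lambda> v)" using L2_abs by simp
  note s2 = smoothing[where \<phi> = "\<lambda>v. (norm v)\<^sup>2", OF _ _ L2' gv2]
  have a_diff: "\<bar>a t - mass t * marg t\<bar> \<le> \<theta> t powr \<nu> * (spread * ?L0)" for t
    using s0(2)[OF one] by (simp add: a_def marginal1_def)
  have b_diff: "norm (b t - (mass t * marg t) *\<^sub>R regr t) \<le> \<theta> t powr \<nu> * (spread * ?L1)" for t
    using s1(2)[OF one] by (simp add: b_def regr_eq)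
  \<comment> \<open>The strength \<open>mass t * marg t\<close> of the pull is eventually at least
    \<open>c * g1\<close>. Each moment constant is a main term, bounded by means of the total kernel
    mass \<open>?KI\<close>, plus the smoothing error at the largest window
    \<open>T\<close>.\<close>
  have "projected_regression M C N xo yo k \<rho> (\<lambda>t. Kb / \<theta> t ^ CARD('r)) a \<epsilon> (\<lambda>t. mass t * marg t) \<delta> b regr
      (?KI * g1bar + T powr \<nu> * (spread * ?L0)) (?KI * G + T powr \<nu> * (spread * ?L2)) (c * g1)
      (\<lambda>t \<omega>. sqg_estimate C K x \<rho> \<theta> N (\<lambda>s i. xo s i \<omega>) (\<lambda>s i. yo s i \<omega>) z0 t) z0"
  proof
    show "k t u \<le> Kb / \<theta> t ^ CARD('r)" for t u
      using Kb \<theta>[of t] by (simp add: scaled_kernel_def divide_right_mono)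
    fix t i assume i: "i \<in> {1..N t}"
    show "integrable M (\<lambda>\<omega>. k t (xo t i \<omega>))" by (rule s0(1)[OF i]) simp
    show "integrable M (\<lambda>\<omega>. k t (xo t i \<omega>) *\<^sub>R yo t i \<omega>)" by (rule s1(1)[OF i]) simp
    show "integrable M (\<lambda>\<omega>. k t (xo t i \<omega>) * (norm (yo t i \<omega>))\<^sup>2)" using s2(1)[OF i] by simp
    have [measurable]: "k t \<in> borel_measurable borel" by (rule k_measurable)
    have [measurable]: "(fst :: (real^'r) \<times> (real^'m) \<Rightarrow> _) \<in> borel_measurable borel"
        "(snd :: (real^'r) \<times> (real^'m) \<Rightarrow> _) \<in> borel_measurable borel"
      by (auto intro!: borel_measurable_continuous_onI continuous_intros)
    note eq = sampled_from_expectation_eq[OF samp[OF i] samp[OF one]]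
    show "(\<integral>\<omega>. k t (xo t i \<omega>) \<partial>M) = a t"
      using eq[of "\<lambda>p. k t (fst p)"] by (simp add: a_def)
    show "(\<integral>\<omega>. k t (xo t i \<omega>) *\<^sub>R yo t i \<omega> \<partial>M) = b t"
      using eq[of "\<lambda>p. k t (fst p) *\<^sub>R snd p"] by (simp add: b_def)
    have "(LINT v:Y|lborel. g t x v * (norm v)\<^sup>2) \<le> G" using G(2)[of t] by (simp add: mult.commute)
    moreover have "0 \<le> (LINT v:Y|lborel. g t x v * (norm v)\<^sup>2)"
      using dens[of t] x unfolding set_lebesgue_integral_def
      by (intro Bochner_Integration.integral_nonneg) (auto simp: density_on_def indicator_def)
    ultimately have "mass t * (LINT v:Y|lborel. g t x v * (norm v)\<^sup>2) \<le> ?KI * G"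
      using mass_bounds[of t] by (intro mult_mono) auto
    moreover have "(\<integral>\<omega>. k t (xo t i \<omega>) * (norm (yo t i \<omega>))\<^sup>2 \<partial>M) \<le>
        mass t * (LINT v:Y|lborel. g t x v * (norm v)\<^sup>2) + \<theta> t powr \<nu> * (spread * ?L2)"
      using s2(2)[OF i] by (simp add: abs_le_iff)
    moreover have "\<theta> t powr \<nu> * (spread * ?L2) \<le> T powr \<nu> * (spread * ?L2)"
      using \<theta>T L_nonneg spread_nonneg by (intro mult_right_mono) auto
    ultimately show "(\<integral>\<omega>. k t (xo t i \<omega>) * (norm (yo t i \<omega>))\<^sup>2 \<partial>M) \<le> ?KI * G + T powr \<nu> * (spread * ?L2)" by linarith
  next
    fix t
    have "mass t * marg t \<le> ?KI * g1bar"
      using mass_bounds[of t] marg_le[of t] marg_pos[of t] by (intro mult_mono) auto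
    moreover have "\<theta> t powr \<nu> * (spread * ?L0) \<le> T powr \<nu> * (spread * ?L0)"
      using \<theta>T L_nonneg spread_nonneg by (intro mult_right_mono) auto
    ultimately show "a t \<le> ?KI * g1bar + T powr \<nu> * (spread * ?L0)"
      using a_diff[of t] by linarith
  next
    fix t v assume v: "v \<in> C"
    have "a t *\<^sub>R v - b t - (mass t * marg t) *\<^sub>R (v - regr t) =
        (a t - mass t * marg t) *\<^sub>R v - (b t - (mass t * marg t) *\<^sub>R regr t)"
      by (simp add: algebra_simps)
    also have "norm \<dots> \<le> \<bar>a t - mass t * marg t\<bar> * norm v + norm (b t - (mass t * marg t) *\<^sub>R regr t)"
      by (rule order_trans[OF norm_triangle_ineq4]) simp
    also have "\<dots> \<le> \<theta> t powr \<nu> * (spread * ?L0) * r + \<theta> t powr \<nu> * (spread * ?L1)"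
      using a_diff b_diff r[OF v] L_nonneg spread_nonneg by (intro add_mono mult_mono) auto
    also have "\<dots> = \<epsilon> t" by (simp add: \<epsilon>_def algebra_simps)
    finally show "norm (a t *\<^sub>R v - b t - (mass t * marg t) *\<^sub>R (v - regr t)) \<le> \<epsilon> t" .
  next
    have "(\<lambda>t. \<theta> t powr \<nu>) \<longlonglongrightarrow> 0"
      using \<theta> \<nu> by (intro tendsto_zero_powrI[OF \<theta>0 tendsto_const]) (auto intro!: always_eventually less_imp_le)
    then show "\<epsilon> \<longlonglongrightarrow> 0" unfolding \<epsilon>_def by (rule tendsto_mult_left_zero)
    show "\<forall>\<^sub>F t in sequentially. c * g1 \<le> mass t * marg t"
      using c(2) by eventually_elim (use c g1 marg_ge in \<open>auto intro!: mult_mono\<close>)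
    show "0 < c * g1" using c g1 by simp
    show "summable (\<lambda>t. (\<rho> t)\<^sup>2 * (Kb / \<theta> t ^ CARD('r)))"
      using summable_mult[OF \<rho>2, of Kb] by (simp add: mult_ac)
    show "summable (\<lambda>t. (\<rho> t)\<^sup>2)"
    \<comment> \<open>Bounded windows give the factor \<open>T ^ CARD('r)\<close> by which the
      squared steps are dominated by the given series.\<close>
    proof (rule summable_comparison_test')
      show "summable (\<lambda>t. (\<rho> t)\<^sup>2 / \<theta> t ^ CARD('r) * T ^ CARD('r))" by (rule summable_mult2[OF \<rho>2])
      fix t
      have "\<theta> t ^ CARD('r) \<le> T ^ CARD('r)" using T[of t] \<theta>[of t] by (intro power_mono) auto
      then have "(\<rho> t)\<^sup>2 * \<theta> t ^ CARD('r) \<le> (\<rho> t)\<^sup>2 * T ^ CARD('r)" by (intro mult_left_mono) auto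
      then show "norm ((\<rho> t)\<^sup>2) \<le> (\<rho> t)\<^sup>2 / \<theta> t ^ CARD('r) * T ^ CARD('r)"
        using \<theta>[of t] by (simp add: field_simps)
    qed
  next
    fix t \<omega>
    let ?z = "sqg_estimate C K x \<rho> \<theta> N (\<lambda>s i. xo s i \<omega>) (\<lambda>s i. yo s i \<omega>) z0"
    have "sqg_direction K x (\<theta> t) (N t) (\<lambda>i. xo t i \<omega>) (\<lambda>i. yo t i \<omega>) (?z t) =
        (1 / real (N t)) *\<^sub>R (\<Sum>i=1..N t. k t (xo t i \<omega>) *\<^sub>R (?z t - yo t i \<omega>))"
      by (simp add: sqg_direction_def scaled_kernel_def scaleR_sum_right divide_inverse mult_ac)
    then show "?z (Suc t) = closest_point C (?z t - \<rho> t *\<^sub>R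
        ((1 / real (N t)) *\<^sub>R (\<Sum>i=1..N t. k t (xo t i \<omega>) *\<^sub>R (?z t - yo t i \<omega>))))"
      by (simp add: Let_def)
  qed (use C z0 regr_in N indep k_measurable k_nonneg \<delta> \<delta>\<rho> \<rho> \<rho>0 \<rho>_div in auto)
  then show ?thesis by (rule projected_regression.tracking)
qed

end

theorem theorem9:
  fixes M :: "'w measure"
    and X :: "(real^'r) set" and Y :: "(real^'m) set"
    and g :: "nat \<Rightarrow> real^'r \<Rightarrow> real^'m \<Rightarrow> real"
    and Yx :: "real^'r \<Rightarrow> (real^'m) set"
    and K :: "real^'r \<Rightarrow> real" and L :: "real^'m \<Rightarrow> real"
    and N :: "nat \<Rightarrow> nat"
    and xo :: "nat \<Rightarrow> nat \<Rightarrow> 'w \<Rightarrow> real^'r" and yo :: "nat \<Rightarrow> nat \<Rightarrow> 'w \<Rightarrow> real^'m"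
    and \<rho> \<theta> :: "nat \<Rightarrow> real" and \<delta> :: "nat \<Rightarrow> real^'r \<Rightarrow> real"
    and g1 :: "real^'r \<Rightarrow> real"
    and \<nu> g1bar g3bar Kbar :: real
    and x :: "real^'r" and z0 :: "real^'m"
    and y :: "nat \<Rightarrow> real^'r \<Rightarrow> real^'m" and z :: "nat \<Rightarrow> 'w \<Rightarrow> real^'m"
  defines "y \<equiv> \<lambda>t. regression Y (g t)"
    and "z \<equiv> \<lambda>t \<omega>. sqg_estimate (Yx x) K x \<rho> \<theta> N
                  (\<lambda>s i. xo s i \<omega>) (\<lambda>s i. yo s i \<omega>) z0 t"
  assumes "prob_space M"
    and "X \<in> sets borel" and "Y \<in> sets borel"
    and "\<And>t. density_on X Y (g t)"
    and "\<And>t. 1 \<le> N t"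
    and "\<And>t i. i \<in> {1..N t} \<Longrightarrow> sampled_from M X Y (g t) (xo t i) (yo t i)"
    and "prob_space.indep_vars M (\<lambda>_. borel) (\<lambda>(t, i) \<omega>. (xo t i \<omega>, yo t i \<omega>))
           (SIGMA t:UNIV. {1..N t})"
    and "x \<in> X" and "convex (Yx x)" and "compact (Yx x)" and "z0 \<in> Yx x"
    \<comment> \<open>(i)\<close>
    and "\<And>t. y t x \<in> Yx x"
    and "\<And>t. norm (y (Suc t) x - y t x) \<le> \<delta> t x"
    and "(\<lambda>t. \<delta> t x) \<longlonglongrightarrow> 0"
    \<comment> \<open>(ii)\<close>
    and "\<nu> > 0"
    and "globally_hoelder X Y \<nu> L g"
    and "set_integrable lborel Y L"
    and "set_integrable lborel Y (\<lambda>v. (norm v)\<^sup>2 * L v)"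
    and "bdd_above (norm ` Yx x)"
    and "\<And>t. g1 x \<le> marginal1 Y (g t) x"
    and "\<And>t. marginal1 Y (g t) x \<le> g1bar"
    and "\<And>t. set_integrable lborel Y (\<lambda>v. (norm v)\<^sup>2 * marginal2 X (g t) v)"
    and "\<And>t. (LINT v:Y|lborel. (norm v)\<^sup>2 * marginal2 X (g t) v) \<le> g3bar"
    \<comment> \<open>(iii)\<close>
    and "K \<in> borel_measurable borel"
    and "\<And>u. 0 \<le> K u"
    and "bounded (range K)"
    and "(LINT u:X|lborel. K u) = 1"
    and "\<And>u. u \<in> X \<Longrightarrow> K u \<le> Kbar"
    and "integrable lborel (\<lambda>u. norm u powr \<nu> * K u)"
    and "window_retained X K x \<theta>"
    \<comment> \<open>(iv)\<close>
    and "\<And>t. \<rho> t > 0" and "\<And>t. \<theta> t > 0"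
    and "(\<lambda>t. \<delta> t x / \<rho> t) \<longlonglongrightarrow> 0"
    and "\<rho> \<longlonglongrightarrow> 0" and "\<theta> \<longlonglongrightarrow> 0"
    and "filterlim (\<lambda>n. \<Sum>t<n. \<rho> t) at_top sequentially"
    and "summable (\<lambda>t. (\<rho> t)\<^sup>2 / \<theta> t ^ CARD('r))"
    and "g1 x > 0"
  shows "AE \<omega> in M. (\<lambda>t. z t \<omega> - y t x) \<longlonglongrightarrow> 0"
proof -
  interpret prob_space M by fact
  have "sqg_regression M X Y g (Yx x) K L N xo yo \<rho> \<theta> (\<lambda>t. \<delta> t x) \<nu> (g1 x) g1bar g3bar x z0"
    by unfold_locales (fact assms[unfolded y_def])+
  then show ?thesis
    unfolding y_def z_def by (rule sqg_regression.consistent)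
qed

end
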